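(* Let $\rho\geq1$ be a real number and let $A$ be a bounded operator on a complex Hilbert space $H$ such that the spectrum of $A$ is contained in $D$. Then $A$ is a $\rho$-contraction if and only if $$1-2\Big(1-\frac{1}{\rho}\Big)\mathrm{Re}(\overline{z}A)-\Big(\frac{1}{\rho^{2}}-\Big(1-\frac{1}{\rho}\Big)^{2}|z|^{2}\Big)A^{*}A\geq0$$ for all $z\in\overline{D}$.
   Context: $D$ is the open unit disk in $\mathbb{C}$ centered at the origin and $\overline{D}$ its closure. For a bounded operator $T$ on $H$, $\mathrm{Re}(T)=\frac12(T+T^{*})$; scalars are identified with multiples of the identity operator, and $T\geq0$ means that $T$ is a positive semidefinite operator. For a bounded operator $A$ on a Hilbert space $H$ and $\rho\geq1$, a unitary $\rho$-dilation of $A$ is a unitary operator $U$ on a Hilbert space $\mathfrak{H}$ containing $H$ as a closed subspace such that $A^{n}x=\rho\,\mathbf{P}U^{n}x$ for all $x\in H$ and $n=1,2,\ldots$, where $\mathbf{P}$ is the orthogonal projection from $\mathfrak{H}$ onto $H$. The operator $A$ is called a $\rho$-contraction if it has a unitary $\rho$-dilation. *)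

theory Defs
  imports "HOL-Analysis.Analysis" "HOL-Library.Function_Algebras"
begin

section \<open>Complex Hilbert spaces\<close>

class complex_vector = ab_group_add +
  fixes scaleC :: "complex \<Rightarrow> 'a \<Rightarrow> 'a"  (infixr "*\<^sub>C" 75)
  assumes scaleC_add_right: "c *\<^sub>C (x + y) = c *\<^sub>C x + c *\<^sub>C y"
    and scaleC_add_left: "(c + d) *\<^sub>C x = c *\<^sub>C x + d *\<^sub>C x"
    and scaleC_scaleC: "c *\<^sub>C d *\<^sub>C x = (c * d) *\<^sub>C x"
    and scaleC_one: "1 *\<^sub>C x = x"

text \<open>A complex Hilbert space is presented as a real Hilbert space with a compatible complex
  structure, so that the library's norm, limits and bounded linear maps apply. Positivity of
  \<open>cinner\<close> and \<open>norm x = sqrt (Re (cinner x x))\<close> are inherited from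
  the class \<open>real_inner\<close>. The inner product is linear in its first argument.\<close>

class chilbert_space = complex_vector + real_inner + complete_space +
  fixes cinner :: "'a \<Rightarrow> 'a \<Rightarrow> complex"
  assumes scaleR_scaleC: "r *\<^sub>R x = complex_of_real r *\<^sub>C x"
    and cinner_commute: "cinner x y = cnj (cinner y x)"
    and cinner_add_left: "cinner (x + y) z = cinner x z + cinner y z"
    and cinner_scaleC_left: "cinner (c *\<^sub>C x) y = c * cinner x y"
    and inner_eq_Re_cinner: "inner x y = Re (cinner x y)"

instantiation complex :: chilbert_space
begin
definition scaleC_complex :: "complex \<Rightarrow> complex \<Rightarrow> complex"
  where "scaleC_complex c x = c * x"
definition cinner_complex :: "complex \<Rightarrow> complex \<Rightarrow> complex"
  where "cinner_complex x y = x * cnj y"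
instance
  by standard
    (auto simp: scaleC_complex_def cinner_complex_def algebra_simps scaleR_conv_of_real
      inner_complex_def)
end

instantiation "fun" :: (type, complex_vector) complex_vector
begin
definition scaleC_fun :: "complex \<Rightarrow> ('a \<Rightarrow> 'b) \<Rightarrow> 'a \<Rightarrow> 'b"
  where "scaleC_fun c f = (\<lambda>i. c *\<^sub>C f i)"
instance
  by standard
    (auto simp: scaleC_fun_def fun_eq_iff scaleC_add_right scaleC_add_left scaleC_scaleC
      scaleC_one)
end


section \<open>Bounded operators\<close>

definition bounded_clinear :: "('a::chilbert_space \<Rightarrow> 'a) \<Rightarrow> bool" where
  "bounded_clinear A \<longleftrightarrow> bounded_linear A \<and> (\<forall>c x. A (c *\<^sub>C x) = c *\<^sub>C A x)"

definition cadjoint :: "('a::chilbert_space \<Rightarrow> 'a) \<Rightarrow> 'a \<Rightarrow> 'a" where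
  "cadjoint A = (THE B. \<forall>x y. cinner (A x) y = cinner x (B y))"

definition Re_op :: "('a::chilbert_space \<Rightarrow> 'a) \<Rightarrow> 'a \<Rightarrow> 'a" where
  "Re_op T = (\<lambda>x. (1 / 2) *\<^sub>R (T x + cadjoint T x))"

definition positive_op :: "('a::chilbert_space \<Rightarrow> 'a) \<Rightarrow> bool" where
  "positive_op T \<longleftrightarrow> (\<forall>x. cinner (T x) x \<in> \<real> \<and> 0 \<le> Re (cinner (T x) x))"

definition op_spectrum :: "('a::chilbert_space \<Rightarrow> 'a) \<Rightarrow> complex set" where
  "op_spectrum A =
    {c. \<not> (\<exists>B. bounded_clinear B \<and>
      (\<forall>x. B (A x - c *\<^sub>C x) = x) \<and> (\<forall>x. A (B x) - c *\<^sub>C B x = x))}"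


section \<open>Dilations\<close>

text \<open>The dilation space is quantified existentially, so it is given by a carrier rather than by a
  type: a linear subspace \<open>S\<close> of a complex vector space together with an inner product
  \<open>ip\<close> (unrelated to any norm on the surrounding type) for which \<open>S\<close> is complete.\<close>

locale hilbert_space_on =
  fixes S :: "'b::complex_vector set" and ip :: "'b \<Rightarrow> 'b \<Rightarrow> complex"
  assumes zero_mem: "0 \<in> S"
    and add_mem: "\<lbrakk>x \<in> S; y \<in> S\<rbrakk> \<Longrightarrow> x + y \<in> S"
    and scaleC_mem: "x \<in> S \<Longrightarrow> c *\<^sub>C x \<in> S"
    and ip_commute: "\<lbrakk>x \<in> S; y \<in> S\<rbrakk> \<Longrightarrow> ip x y = cnj (ip y x)"
    and ip_add_left: "\<lbrakk>x \<in> S; y \<in> S; z \<in> S\<rbrakk> \<Longrightarrow> ip (x + y) z = ip x z + ip y z"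
    and ip_scaleC_left: "\<lbrakk>x \<in> S; y \<in> S\<rbrakk> \<Longrightarrow> ip (c *\<^sub>C x) y = c * ip x y"
    and ip_pos: "\<lbrakk>x \<in> S; x \<noteq> 0\<rbrakk> \<Longrightarrow> 0 < Re (ip x x)"
    and complete_on:
      "\<lbrakk>\<And>n. X n \<in> S;
        \<And>e. 0 < e \<Longrightarrow> \<exists>N. \<forall>m\<ge>N. \<forall>n\<ge>N. sqrt (Re (ip (X m - X n) (X m - X n))) < e\<rbrakk>
       \<Longrightarrow> \<exists>l\<in>S. (\<lambda>n::nat. sqrt (Re (ip (X n - l) (X n - l)))) \<longlonglongrightarrow> 0"

definition unitary_on ::
  "'b::complex_vector set \<Rightarrow> ('b \<Rightarrow> 'b \<Rightarrow> complex) \<Rightarrow> ('b \<Rightarrow> 'b) \<Rightarrow> bool" where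
  "unitary_on S ip U \<longleftrightarrow>
    bij_betw U S S \<and>
    (\<forall>x\<in>S. \<forall>y\<in>S. U (x + y) = U x + U y) \<and>
    (\<forall>c. \<forall>x\<in>S. U (c *\<^sub>C x) = c *\<^sub>C U x) \<and>
    (\<forall>x\<in>S. \<forall>y\<in>S. ip (U x) (U y) = ip x y)"

text \<open>The inclusion of \<open>H\<close> in the dilation space is a linear isometry \<open>J\<close>. Its range is
  automatically closed, since \<open>H\<close> is complete.\<close>

definition isometric_embedding ::
  "'b::complex_vector set \<Rightarrow> ('b \<Rightarrow> 'b \<Rightarrow> complex) \<Rightarrow> ('a::chilbert_space \<Rightarrow> 'b) \<Rightarrow> bool" where
  "isometric_embedding S ip J \<longleftrightarrow>
    range J \<subseteq> S \<and>
    (\<forall>x y. J (x + y) = J x + J y) \<and>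
    (\<forall>c x. J (c *\<^sub>C x) = c *\<^sub>C J x) \<and>
    (\<forall>x y. ip (J x) (J y) = cinner x y)"

definition orthogonal_projection_on ::
  "'b::complex_vector set \<Rightarrow> ('b \<Rightarrow> 'b \<Rightarrow> complex) \<Rightarrow> 'b set \<Rightarrow> ('b \<Rightarrow> 'b) \<Rightarrow> bool" where
  "orthogonal_projection_on S ip M P \<longleftrightarrow>
    (\<forall>k\<in>S. P k \<in> M \<and> (\<forall>m\<in>M. ip (k - P k) m = 0))"

definition unitary_rho_dilation ::
  "real \<Rightarrow> ('a::chilbert_space \<Rightarrow> 'a) \<Rightarrow> 'b::complex_vector set \<Rightarrow> ('b \<Rightarrow> 'b \<Rightarrow> complex)
    \<Rightarrow> ('a \<Rightarrow> 'b) \<Rightarrow> ('b \<Rightarrow> 'b) \<Rightarrow> bool" where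
  "unitary_rho_dilation \<rho> A S ip J U \<longleftrightarrow>
    hilbert_space_on S ip \<and> isometric_embedding S ip J \<and> unitary_on S ip U \<and>
    (\<exists>P. orthogonal_projection_on S ip (range J) P \<and>
      (\<forall>n\<ge>1. \<forall>x. J ((A ^^ n) x) = complex_of_real \<rho> *\<^sub>C P ((U ^^ n) (J x))))"

text \<open>Here the dilation space is carried by a subset of the type \<open>int \<Rightarrow> 'a\<close>. This loses no
  generality: by the lemma \<open>unitary_rho_dilation_imp_rho_contraction\<close> below, a unitary dilation
  on a space of any type can be replaced by one of this form.\<close>

definition rho_contraction :: "real \<Rightarrow> ('a::chilbert_space \<Rightarrow> 'a) \<Rightarrow> bool" where
  "rho_contraction \<rho> A \<longleftrightarrow>
    (\<exists>(S :: (int \<Rightarrow> 'a) set) ip J U. unitary_rho_dilation \<rho> A S ip J U)"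


section \<open>Independence of the carrier type\<close>

lemma scaleC_zero_left: "0 *\<^sub>C (x::'b::complex_vector) = 0"
  using scaleC_add_left[of 0 0 x] by simp

lemma scaleC_zero_right: "c *\<^sub>C (0::'b::complex_vector) = 0"
  using scaleC_add_right[of c 0 "0::'b"] by simp

lemma scaleC_minus_one: "(-1) *\<^sub>C (x::'b::complex_vector) = - x"
  using scaleC_add_left[of "-1" 1 x]
  by (simp add: scaleC_one scaleC_zero_left eq_neg_iff_add_eq_0)

context hilbert_space_on
begin

lemma minus_mem: "x \<in> S \<Longrightarrow> - x \<in> S"
  using scaleC_mem[of x "-1"] by (simp add: scaleC_minus_one)

lemma diff_mem: "x \<in> S \<Longrightarrow> y \<in> S \<Longrightarrow> x - y \<in> S"
  using add_mem[of x "- y"] minus_mem[of y] by simp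

lemma ip_diff_left: "x \<in> S \<Longrightarrow> y \<in> S \<Longrightarrow> z \<in> S \<Longrightarrow> ip (x - y) z = ip x z - ip y z"
  using ip_add_left[of x "- y" z] ip_scaleC_left[of y z "-1"] minus_mem[of y]
  by (simp add: scaleC_minus_one)

lemma ip_zero_left: "z \<in> S \<Longrightarrow> ip 0 z = 0"
  using ip_diff_left[of 0 0 z] zero_mem by simp

lemma ip_add_right: "x \<in> S \<Longrightarrow> y \<in> S \<Longrightarrow> z \<in> S \<Longrightarrow> ip z (x + y) = ip z x + ip z y"
  using ip_commute[of z "x + y"] ip_commute[of z x] ip_commute[of z y] ip_add_left[of x y z]
    add_mem[of x y] by simp

lemma ip_diff_right: "x \<in> S \<Longrightarrow> y \<in> S \<Longrightarrow> z \<in> S \<Longrightarrow> ip z (x - y) = ip z x - ip z y"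
  using ip_commute[of z "x - y"] ip_commute[of z x] ip_commute[of z y] ip_diff_left[of x y z]
    diff_mem[of x y] by simp

lemma ip_scaleC_right: "x \<in> S \<Longrightarrow> z \<in> S \<Longrightarrow> ip z (c *\<^sub>C x) = cnj c * ip z x"
  using ip_commute[of z "c *\<^sub>C x"] ip_commute[of z x] ip_scaleC_left[of x z c]
    scaleC_mem[of x c] by simp

lemma ip_self_nonneg: "x \<in> S \<Longrightarrow> 0 \<le> Re (ip x x)"
  using ip_pos[of x] ip_zero_left[OF zero_mem] by (cases "x = 0") auto

lemma hilbert_space_on_orthogonal:
  assumes "N \<subseteq> S"
  shows "hilbert_space_on {k \<in> S. \<forall>m\<in>N. ip k m = 0} ip" (is "hilbert_space_on ?M ip")
proof
  fix X :: "nat \<Rightarrow> 'b"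
  assume XM: "\<And>n. X n \<in> ?M"
    and cau: "\<And>e. 0 < e \<Longrightarrow> \<exists>N. \<forall>m\<ge>N. \<forall>n\<ge>N. sqrt (Re (ip (X m - X n) (X m - X n))) < e"
  have XS: "X n \<in> S" for n using XM by auto
  obtain l where l: "l \<in> S" and lim: "(\<lambda>n. sqrt (Re (ip (X n - l) (X n - l)))) \<longlonglongrightarrow> 0"
    using complete_on[OF XS cau] by blast
  have lim2: "(\<lambda>n. Re (ip (X n - l) (X n - l))) \<longlonglongrightarrow> 0"
    using tendsto_power[OF lim, of 2] ip_self_nonneg[OF diff_mem[OF XS l]] by simp
  have "ip l m = 0" if m: "m \<in> N" for m
  proof (rule ccontr)
    assume c: "ip l m \<noteq> 0"
    have mS: "m \<in> S" using m assms by auto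
    define q where "q = (cmod (ip l m))\<^sup>2"
    have q: "q > 0" using c by (simp add: q_def)
    have main: "0 \<le> - 2 * s * q + s\<^sup>2 * q * Re (ip m m)" for s :: real
    proof -
      define t where "t = - (complex_of_real s * ip l m)"
      have "0 \<le> Re (ip (X n - l) (X n - l)) - 2 * s * q + s\<^sup>2 * q * Re (ip m m)" for n
      proof -
        define d where "d = X n - l"
        have dS: "d \<in> S" using diff_mem XS l by (simp add: d_def)
        have dm: "ip d m = - ip l m"
          using ip_diff_left[OF XS l mS] XM m by (simp add: d_def)
        have md: "ip m d = - cnj (ip l m)"
          using ip_commute[OF mS dS] dm by simp
        have tm: "t *\<^sub>C m \<in> S" using scaleC_mem mS by simp
        have "ip (d - t *\<^sub>C m) (d - t *\<^sub>C m)
            = ip d d - cnj t * ip d m - t * ip m d + t * cnj t * ip m m"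
          using dS mS tm diff_mem[OF dS tm]
          by (simp add: ip_diff_left ip_diff_right ip_scaleC_left ip_scaleC_right algebra_simps)
        also have "\<dots> = ip d d - complex_of_real (2 * s * q) + complex_of_real (s\<^sup>2 * q) * ip m m"
        proof -
          have "ip l m * cnj (ip l m) = complex_of_real q"
            unfolding q_def by (simp add: complex_mult_cnj cmod_power2)
          then have "cnj (ip l m) * ip l m = complex_of_real q" 
            "ip l m * cnj (ip l m) = complex_of_real q" by (simp_all add: mult.commute)
          then show ?thesis
            unfolding dm md t_def
            by (simp add: algebra_simps power2_eq_square)
        qed
        finally have "Re (ip (d - t *\<^sub>C m) (d - t *\<^sub>C m))
            = Re (ip d d) - 2 * s * q + s\<^sup>2 * q * Re (ip m m)"
          by (simp del: of_real_mult of_real_power)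
        then show ?thesis
          using ip_self_nonneg[OF diff_mem[OF dS tm]] by (simp add: d_def)
      qed
      moreover have "(\<lambda>n. Re (ip (X n - l) (X n - l)) - 2 * s * q + s\<^sup>2 * q * Re (ip m m))
          \<longlonglongrightarrow> 0 - 2 * s * q + s\<^sup>2 * q * Re (ip m m)"
        by (intro tendsto_intros lim2)
      ultimately show ?thesis
        using LIMSEQ_le_const[of _ "0 - 2 * s * q + s\<^sup>2 * q * Re (ip m m)" 0] by fastforce
    qed
    define s where "s = 1 / (1 + Re (ip m m))"
    have mm: "0 \<le> Re (ip m m)" using ip_self_nonneg mS by simp
    have s: "s > 0" "s * Re (ip m m) \<le> 1"
      using mm by (auto simp: s_def divide_simps)
    have "- 2 * s * q + s\<^sup>2 * q * Re (ip m m) = s * q * (s * Re (ip m m) - 2)"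
      by (simp add: algebra_simps power2_eq_square)
    also have "\<dots> < 0" using s q by (intro mult_pos_neg) auto
    finally show False using main[of s] by simp
  qed
  with l lim show "\<exists>l\<in>?M. (\<lambda>n. sqrt (Re (ip (X n - l) (X n - l)))) \<longlonglongrightarrow> 0" by auto
qed (use assms in \<open>auto simp: zero_mem add_mem scaleC_mem ip_add_left ip_scaleC_left ip_zero_left
       subset_iff ip_pos intro: ip_commute\<close>)

end

lemma unitary_on_funpow:
  assumes "unitary_on S ip U"
  shows "unitary_on S ip (U ^^ n)"
proof (induction n)
  case (Suc n)
  have mem: "x \<in> S \<Longrightarrow> (U ^^ n) x \<in> S" for x
    using Suc by (auto simp: unitary_on_def bij_betw_def)
  have "bij_betw (U \<circ> U ^^ n) S S"
    using Suc assms by (auto simp: unitary_on_def intro: bij_betw_trans)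
  then show ?case
    using Suc assms mem by (simp add: unitary_on_def comp_def)
qed (auto simp: unitary_on_def bij_betw_def)

lemma unitary_on_inv_into:
  assumes "hilbert_space_on S ip" "unitary_on S ip U"
  shows "unitary_on S ip (inv_into S U)"
proof -
  interpret hilbert_space_on S ip by fact
  let ?V = "inv_into S U"
  have inj: "inj_on U S" and im: "U ` S = S"
    using assms(2) by (auto simp: unitary_on_def bij_betw_def)
  have V: "?V x \<in> S" "U (?V x) = x" if "x \<in> S" for x
    using that im by (auto intro: inv_into_into f_inv_into_f)
  have Uadd: "\<And>x y. x \<in> S \<Longrightarrow> y \<in> S \<Longrightarrow> U (x + y) = U x + U y"
    and Uscale: "\<And>c x. x \<in> S \<Longrightarrow> U (c *\<^sub>C x) = c *\<^sub>C U x"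
    and Uip: "\<And>x y. x \<in> S \<Longrightarrow> y \<in> S \<Longrightarrow> ip (U x) (U y) = ip x y"
    using assms(2) by (simp_all add: unitary_on_def)
  have eqI: "x = y" if "U x = U y" "x \<in> S" "y \<in> S" for x y
    using inj that by (auto dest: inj_onD)
  show ?thesis
    unfolding unitary_on_def
  proof (intro conjI ballI allI)
    show "bij_betw ?V S S"
      by (rule bij_betw_inv_into) (use assms(2) in \<open>simp add: unitary_on_def\<close>)
  next
    fix x y assume xy: "x \<in> S" "y \<in> S"
    have "U (?V (x + y)) = U (?V x + ?V y)"
      using Uadd[OF V(1) V(1), OF xy] V(2) xy add_mem by simp
    then show "?V (x + y) = ?V x + ?V y"
      by (rule eqI) (use V(1) xy add_mem in simp_all)
  next
    fix c x assume x: "x \<in> S"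
    have "U (?V (c *\<^sub>C x)) = U (c *\<^sub>C ?V x)"
      using Uscale[OF V(1), OF x] V(2) x scaleC_mem by simp
    then show "?V (c *\<^sub>C x) = c *\<^sub>C ?V x"
      by (rule eqI) (use V(1) x scaleC_mem in simp_all)
  next
    fix x y assume xy: "x \<in> S" "y \<in> S"
    show "ip (?V x) (?V y) = ip x y"
      using Uip[OF V(1) V(1), OF xy] V(2) xy by simp
  qed
qed

lemma unitary_rho_dilation_transport:
  fixes W :: "'b::complex_vector \<Rightarrow> 'c::complex_vector"
  assumes dil: "unitary_rho_dilation \<rho> A S ip J U"
    and inj: "inj_on W S"
    and add: "\<And>x y. x \<in> S \<Longrightarrow> y \<in> S \<Longrightarrow> W (x + y) = W x + W y"
    and scale: "\<And>c x. x \<in> S \<Longrightarrow> W (c *\<^sub>C x) = c *\<^sub>C W x"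
  shows "\<exists>ip' J' U'. unitary_rho_dilation \<rho> A (W ` S) ip' J' U'"
proof -
  obtain P where H: "hilbert_space_on S ip" and emb: "isometric_embedding S ip J"
    and uni: "unitary_on S ip U" and P: "orthogonal_projection_on S ip (range J) P"
    and pow: "\<And>n x. n \<ge> 1 \<Longrightarrow> J ((A ^^ n) x) = complex_of_real \<rho> *\<^sub>C P ((U ^^ n) (J x))"
    using dil unfolding unitary_rho_dilation_def by blast
  interpret hilbert_space_on S ip by (fact H)
  define G where "G = inv_into S W"
  have GW [simp]: "G (W x) = x" if "x \<in> S" for x
    using inj that by (simp add: G_def)
  have W0: "W 0 = 0" using add[OF zero_mem zero_mem] by simp
  have diff: "W (x - y) = W x - W y" if "x \<in> S" "y \<in> S" for x y
    using add[OF diff_mem[OF that] that(2)] by simp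
  have diffG: "G (W x - W y) = x - y" if "x \<in> S" "y \<in> S" for x y
    using that diff_mem diff by (metis GW)
  have addG: "G (W x + W y) = x + y" if "x \<in> S" "y \<in> S" for x y
    using that add_mem add by (metis GW)
  have scaleG: "G (c *\<^sub>C W x) = c *\<^sub>C x" if "x \<in> S" for x c
    using that scaleC_mem scale by (metis GW)
  define ip' where "ip' = (\<lambda>f g. ip (G f) (G g))"
  define U' where "U' = (\<lambda>f. W (U (G f)))"
  define P' where "P' = (\<lambda>f. W (P (G f)))"
  define J' where "J' = (\<lambda>x. W (J x))"
  have JS: "J x \<in> S" for x using emb by (auto simp: isometric_embedding_def)
  have US: "U x \<in> S" if "x \<in> S" for x
    using uni that by (auto simp: unitary_on_def bij_betw_def)
  have PS: "P x \<in> S" if "x \<in> S" for x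
    using P that JS by (force simp: orthogonal_projection_on_def)
  have H': "hilbert_space_on (W ` S) ip'"
  proof
    show "0 \<in> W ` S" using W0 zero_mem by (metis imageI)
  next
    fix x y assume "x \<in> W ` S" "y \<in> W ` S"
    then show "x + y \<in> W ` S" by (auto simp: add[symmetric] add_mem)
  next
    fix c x assume "x \<in> W ` S"
    then show "c *\<^sub>C x \<in> W ` S" by (auto simp: scale[symmetric] scaleC_mem)
  next
    fix x y assume "x \<in> W ` S" "y \<in> W ` S"
    then show "ip' x y = cnj (ip' y x)" by (auto simp: ip'_def intro: ip_commute)
  next
    fix x y z assume "x \<in> W ` S" "y \<in> W ` S" "z \<in> W ` S"
    then show "ip' (x + y) z = ip' x z + ip' y z"
      by (auto simp: ip'_def addG ip_add_left)
  next
    fix x y c assume "x \<in> W ` S" "y \<in> W ` S"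
    then show "ip' (c *\<^sub>C x) y = c * ip' x y"
      by (auto simp: ip'_def scaleG ip_scaleC_left)
  next
    fix x assume "x \<in> W ` S" "x \<noteq> 0"
    then obtain y where "y \<in> S" "x = W y" "y \<noteq> 0" using W0 by auto
    then show "0 < Re (ip' x x)" by (simp add: ip'_def ip_pos)
  next
    fix X :: "nat \<Rightarrow> 'c"
    assume XS: "\<And>n. X n \<in> W ` S"
      and cau: "\<And>e. 0 < e \<Longrightarrow>
        \<exists>N. \<forall>m\<ge>N. \<forall>n\<ge>N. sqrt (Re (ip' (X m - X n) (X m - X n))) < e"
    define Y where "Y = (\<lambda>n. G (X n))"
    have Y: "Y n \<in> S" "X n = W (Y n)" for n
      using XS[of n] by (auto simp: Y_def)
    have "\<exists>l\<in>S. (\<lambda>n. sqrt (Re (ip (Y n - l) (Y n - l)))) \<longlonglongrightarrow> 0"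
      by (rule complete_on[OF Y(1)]) (use cau in \<open>simp add: Y(2) ip'_def diffG[OF Y(1) Y(1)]\<close>)
    then show "\<exists>l\<in>W ` S. (\<lambda>n. sqrt (Re (ip' (X n - l) (X n - l)))) \<longlonglongrightarrow> 0"
      by (auto simp: Y ip'_def diffG)
  qed
  have emb': "isometric_embedding (W ` S) ip' J'"
    using emb JS by (auto simp: isometric_embedding_def J'_def ip'_def add scale)
  have uni': "unitary_on (W ` S) ip' U'"
    unfolding unitary_on_def
  proof (intro conjI ballI allI)
    have "U' ` W ` S = W ` U ` S" by (auto simp: U'_def image_iff)
    moreover have "U ` S = S" and injU: "inj_on U S"
      using uni by (auto simp: unitary_on_def bij_betw_def)
    moreover have "inj_on U' (W ` S)"
    proof (rule inj_onI)
      fix f g assume "f \<in> W ` S" "g \<in> W ` S" "U' f = U' g"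
      then obtain x y where xy: "x \<in> S" "y \<in> S" "f = W x" "g = W y" "W (U x) = W (U y)"
        by (auto simp: U'_def)
      have "U x = U y" using inj_onD[OF inj xy(5)] US xy by simp
      then show "f = g" using inj_onD[OF injU _ xy(1,2)] xy(3,4) by metis
    qed
    ultimately show "bij_betw U' (W ` S) (W ` S)" by (simp add: bij_betw_def)
  next
    fix f g assume "f \<in> W ` S" "g \<in> W ` S"
    then show "U' (f + g) = U' f + U' g" "ip' (U' f) (U' g) = ip' f g"
      using uni US by (auto simp: U'_def ip'_def addG unitary_on_def add)
  next
    fix c f assume "f \<in> W ` S"
    then show "U' (c *\<^sub>C f) = c *\<^sub>C U' f"
      using uni US by (auto simp: U'_def scaleG unitary_on_def scale)
  qed
  have P': "orthogonal_projection_on (W ` S) ip' (range J') P'"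
    unfolding orthogonal_projection_on_def
  proof (intro ballI conjI)
    fix f assume "f \<in> W ` S"
    then show "P' f \<in> range J'"
      using P by (fastforce simp: orthogonal_projection_on_def P'_def J'_def)
  next
    fix f m assume "f \<in> W ` S" "m \<in> range J'"
    then obtain k x where "k \<in> S" "f = W k" "m = W (J x)" by (auto simp: J'_def)
    then show "ip' (f - P' f) m = 0"
      using P JS PS by (simp add: ip'_def P'_def diffG orthogonal_projection_on_def)
  qed
  have Upow: "(U' ^^ n) (W x) = W ((U ^^ n) x) \<and> (U ^^ n) x \<in> S" if "x \<in> S" for n x
    using that by (induction n) (simp_all add: U'_def US)
  have "J' ((A ^^ n) x) = complex_of_real \<rho> *\<^sub>C P' ((U' ^^ n) (J' x))" if "n \<ge> 1" for n x
    using pow[OF that, of x] Upow[OF JS, of n x] PS by (simp add: J'_def P'_def scale)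
  with H' emb' uni' P' show ?thesis
    unfolding unitary_rho_dilation_def by blast
qed

lemma unitary_rho_dilation_imp_rho_contraction:
  fixes A :: "'a::chilbert_space \<Rightarrow> 'a" and S :: "'b::complex_vector set"
  assumes dil: "unitary_rho_dilation \<rho> A S ip J U"
  shows "rho_contraction \<rho> A"
proof -
  obtain P where H: "hilbert_space_on S ip" and emb: "isometric_embedding S ip J"
    and uni: "unitary_on S ip U" and P: "orthogonal_projection_on S ip (range J) P"
    and pow: "\<And>n x. n \<ge> 1 \<Longrightarrow> J ((A ^^ n) x) = complex_of_real \<rho> *\<^sub>C P ((U ^^ n) (J x))"
    using dil unfolding unitary_rho_dilation_def by blast
  interpret hilbert_space_on S ip by (fact H)
  have JS: "J x \<in> S" for x using emb by (auto simp: isometric_embedding_def)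
  have Jadd: "J (x + y) = J x + J y" and Jscale: "J (c *\<^sub>C x) = c *\<^sub>C J x"
    and Jip: "ip (J x) (J y) = cinner x y" for x y c
    using emb by (auto simp: isometric_embedding_def)
  have J0: "J 0 = 0" using Jadd[of 0 0] by simp
  have injJ: "inj J"
  proof (rule injI)
    fix x y assume "J x = J y"
    then have "J (x - y) = 0" using Jadd[of "x - y" y] by simp
    then have "inner (x - y) (x - y) = 0"
      using Jip[of "x - y" "x - y"] ip_zero_left[OF zero_mem] by (simp add: inner_eq_Re_cinner)
    then show "x = y" by simp
  qed
  have Pr: "P k \<in> range J" and Po: "ip (k - P k) (J x) = 0" if "k \<in> S" for k x
    using P that by (auto simp: orthogonal_projection_on_def)
  have PS: "P k \<in> S" if "k \<in> S" for k using Pr[OF that] JS by auto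
  have Puniq: "p = P k" if k: "k \<in> S" and p: "p \<in> range J" and o: "\<And>x. ip (k - p) (J x) = 0" for k p
  proof (rule ccontr)
    assume "p \<noteq> P k"
    obtain a b where ab: "p = J a" "P k = J b" using p Pr[OF k] by auto
    have "p - P k = J (a - b)" using Jadd[of "a - b" b] ab by simp
    then have "ip (p - P k) (p - P k) = ip (k - P k) (p - P k) - ip (k - p) (p - P k)"
      using ip_diff_left[of "k - P k" "k - p" "p - P k"] k JS ab by (simp add: diff_mem)
    also have "\<dots> = 0" using \<open>p - P k = J (a - b)\<close> o Po[OF k] by simp
    finally show False using ip_pos[of "p - P k"] \<open>p \<noteq> P k\<close> ab JS by (simp add: diff_mem)
  qed
  have Padd: "P (x + y) = P x + P y" if "x \<in> S" "y \<in> S" for x y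
  proof (rule Puniq[symmetric])
    show "x + y \<in> S" using that add_mem by simp
    show "P x + P y \<in> range J" using Pr[OF that(1)] Pr[OF that(2)] by (auto simp: Jadd[symmetric])
    fix v
    have "x + y - (P x + P y) = (x - P x) + (y - P y)" by simp
    then show "ip (x + y - (P x + P y)) (J v) = 0"
      using that Po PS JS by (simp only: ip_add_left diff_mem) simp
  qed
  have Pscale: "P (c *\<^sub>C x) = c *\<^sub>C P x" if "x \<in> S" for x c
  proof (rule Puniq[symmetric])
    show "c *\<^sub>C x \<in> S" using that scaleC_mem by simp
    show "c *\<^sub>C P x \<in> range J" using Pr[OF that] by (auto simp: Jscale[symmetric])
    fix v
    show "ip (c *\<^sub>C x - c *\<^sub>C P x) (J v) = 0"
      using that Po[OF that, of v] PS JS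
      by (simp add: ip_diff_left ip_scaleC_left scaleC_mem flip: right_diff_distrib)
  qed
  define j where "j = inv J"
  have jJ [simp]: "j (J x) = x" for x using injJ by (simp add: j_def)
  have jadd: "j (x + y) = j x + j y" if "x \<in> range J" "y \<in> range J" for x y
    using that by (auto simp: Jadd[symmetric])
  have jscale: "j (c *\<^sub>C x) = c *\<^sub>C j x" if "x \<in> range J" for x c
    using that by (auto simp: Jscale[symmetric])

  define V where "V = inv_into S U"
  have uniV: "unitary_on S ip V" unfolding V_def by (rule unitary_on_inv_into[OF H uni])
  have VU: "V (U k) = k" if "k \<in> S" for k
    using uni that by (auto simp: V_def unitary_on_def bij_betw_def)
  define Z where "Z = (\<lambda>n::int. if 0 \<le> n then U ^^ nat n else V ^^ nat (- n))"
  have uniZ: "unitary_on S ip (Z n)" for n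
    using unitary_on_funpow[OF uni] unitary_on_funpow[OF uniV] by (simp add: Z_def)
  have ZS: "Z n k \<in> S" if "k \<in> S" for n k
    using uniZ[of n] that by (auto simp: unitary_on_def bij_betw_def)
  have ZU: "Z n (U k) = Z (n + 1) k" if "k \<in> S" for n k
  proof (cases "0 \<le> n")
    case True
    then have "nat (n + 1) = Suc (nat n)" by simp
    with True show ?thesis by (simp add: Z_def funpow_swap1)
  next
    case False
    define m where "m = nat (- n) - 1"
    have m: "n = - int (Suc m)" using False by (simp add: m_def)
    have "Z n (U k) = (V ^^ m) k" using that by (simp add: Z_def m funpow_swap1 VU nat_add_distrib)
    then show ?thesis by (cases m) (simp_all add: Z_def m nat_add_distrib)
  qed

  define W where "W = (\<lambda>k n. j (P (Z n k)))"
  have Wadd: "W (x + y) = W x + W y" if "x \<in> S" "y \<in> S" for x y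
    using that uniZ by (auto simp: W_def fun_eq_iff unitary_on_def Padd ZS jadd Pr)
  have Wscale: "W (c *\<^sub>C x) = c *\<^sub>C W x" if "x \<in> S" for x c
    using that uniZ by (auto simp: W_def fun_eq_iff unitary_on_def Pscale ZS jscale Pr scaleC_fun_def)
  have WU: "W (U k) n = W k (n + 1)" if "k \<in> S" for k n
    using that by (simp add: W_def ZU)
  define N where "N = {k \<in> S. W k = 0}"
  define M where "M = {k \<in> S. \<forall>m\<in>N. ip k m = 0}"
  have NS: "N \<subseteq> S" by (auto simp: N_def)
  have MS: "M \<subseteq> S" by (auto simp: M_def)
  have HM: "hilbert_space_on M ip"
    unfolding M_def by (rule hilbert_space_on_orthogonal[OF NS])
  have injW: "inj_on W M"
  proof (rule inj_onI)
    fix x y assume xy: "x \<in> M" "y \<in> M" "W x = W y"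
    have S: "x \<in> S" "y \<in> S" "x - y \<in> S" using xy MS diff_mem by auto
    have "W (x - y) = 0" using Wadd[of "x - y" y] S xy(3) by simp
    then have "x - y \<in> N" using S by (simp add: N_def)
    then have "ip (x - y) (x - y) = 0" using xy S by (auto simp: M_def ip_diff_left)
    then show "x = y" using ip_pos[OF S(3)] by fastforce
  qed
  have US: "U k \<in> S" if "k \<in> S" for k
    using uni that by (auto simp: unitary_on_def bij_betw_def)
  have Usurj: "\<exists>k'\<in>S. k = U k'" if "k \<in> S" for k
    using uni that by (auto simp: unitary_on_def bij_betw_def)
  have NU: "U k \<in> N \<longleftrightarrow> k \<in> N" if "k \<in> S" for k
  proof -
    have "(\<forall>n. W k (n + 1) = 0) \<longleftrightarrow> (\<forall>n. W k n = 0)" by (metis diff_add_cancel)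
    then show ?thesis using that US WU by (auto simp: N_def fun_eq_iff)
  qed
  have Uip: "ip (U x) (U y) = ip x y" if "x \<in> S" "y \<in> S" for x y
    using uni that by (simp add: unitary_on_def)
  have MU: "U k \<in> M \<longleftrightarrow> k \<in> M" if k: "k \<in> S" for k
  proof
    assume UkM: "U k \<in> M"
    have "ip k m = 0" if "m \<in> N" for m
    proof -
      have "m \<in> S" "U m \<in> N" using that NS NU by auto
      then show ?thesis using UkM Uip[OF k] by (auto simp: M_def)
    qed
    then show "k \<in> M" using k by (simp add: M_def)
  next
    assume kM: "k \<in> M"
    have "ip (U k) m = 0" if m: "m \<in> N" for m
    proof -
      obtain m' where m': "m' \<in> S" "m = U m'" using Usurj[of m] m NS by auto
      then show ?thesis using NU that kM k Uip by (auto simp: M_def)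
    qed
    then show "U k \<in> M" using US k by (simp add: M_def)
  qed
  have "U ` M = M"
  proof
    show "U ` M \<subseteq> M" using MU MS by auto
    show "M \<subseteq> U ` M"
    proof
      fix k assume k: "k \<in> M"
      then obtain k' where "k' \<in> S" "k = U k'" using Usurj[of k] MS by auto
      then show "k \<in> U ` M" using MU k by auto
    qed
  qed
  moreover have "inj_on U M"
    by (rule inj_on_subset[OF _ MS]) (use uni in \<open>simp add: unitary_on_def bij_betw_def\<close>)
  ultimately have "bij_betw U M M" by (simp add: bij_betw_def)
  moreover have "U (x + y) = U x + U y" "ip (U x) (U y) = ip x y" if "x \<in> M" "y \<in> M" for x y
    using uni subsetD[OF MS that(1)] subsetD[OF MS that(2)] by (simp_all add: unitary_on_def)
  moreover have "U (c *\<^sub>C x) = c *\<^sub>C U x" if "x \<in> M" for c x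
    using uni subsetD[OF MS that] by (simp add: unitary_on_def)
  ultimately have uniM: "unitary_on M ip U" unfolding unitary_on_def by blast
  have JM: "J x \<in> M" for x
  proof -
    have "ip (J x) m = 0" if "m \<in> N" for m
    proof -
      have mS: "m \<in> S" using that NS by auto
      have "W m 0 = 0" using that by (simp add: N_def)
      then have "j (P m) = 0" by (simp add: W_def Z_def)
      then have "P m = 0" using Pr[OF mS] J0 by auto
      then have "ip m (J x) = 0" using Po[OF mS, of x] by simp
      then show ?thesis using ip_commute[OF JS mS] by simp
    qed
    then show ?thesis using JS by (simp add: M_def)
  qed
  have embM: "isometric_embedding M ip J"
    using emb JM by (auto simp: isometric_embedding_def)
  have PM: "orthogonal_projection_on M ip (range J) P"
    using P MS by (auto simp: orthogonal_projection_on_def)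
  have dilM: "unitary_rho_dilation \<rho> A M ip J U"
    unfolding unitary_rho_dilation_def using HM embM uniM PM pow by blast
  have WaddM: "W (x + y) = W x + W y" if "x \<in> M" "y \<in> M" for x y
    using Wadd[of x y] that MS by auto
  have WscaleM: "W (c *\<^sub>C x) = c *\<^sub>C W x" if "x \<in> M" for c x
    using Wscale[of x c] that MS by auto
  have "\<exists>ip' J' U'. unitary_rho_dilation \<rho> A (W ` M) ip' J' U'"
    by (rule unitary_rho_dilation_transport[OF dilM injW]) (fact WaddM, fact WscaleM)
  then show ?thesis
    unfolding rho_contraction_def by (rule exI)
qed


section \<open>Existence and uniqueness of the adjoint\<close>

lemma riesz_representation_real:
  fixes f :: "'a::{real_inner, complete_space} \<Rightarrow> real"
  assumes "bounded_linear f"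
  shows "\<exists>v. \<forall>x. f x = inner x v"
proof -
  interpret f: bounded_linear f by fact
  obtain K where K: "\<And>x. norm (f x) \<le> norm x * K" using f.bounded by blast
  define g where "g x = (norm x)\<^sup>2 / 2 - f x" for x
  have lower: "- K\<^sup>2 / 2 \<le> g x" for x
  proof -
    have "f x \<le> norm x * K" using K[of x] by (simp add: abs_le_iff)
    moreover have "0 \<le> (norm x - K)\<^sup>2" by simp
    ultimately show ?thesis by (simp add: g_def power2_eq_square algebra_simps)
  qed
  then have bdd: "bdd_below (range g)" by (auto simp: bdd_below_def)
  define m where "m = Inf (range g)"
  have m_le: "m \<le> g x" for x unfolding m_def by (rule cInf_lower[OF rangeI bdd])
  have "\<exists>x. g x < m + inverse (real (Suc n))" for n
    using cInf_lessD[of "range g" "m + inverse (real (Suc n))"] by (auto simp: m_def)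
  then obtain X where X: "\<And>n. g (X n) < m + inverse (real (Suc n))" by metis
  have par: "(norm (x - y))\<^sup>2 \<le> 4 * ((g x - m) + (g y - m))" for x y
  proof -
    have "(norm ((1/2) *\<^sub>R (x + y)))\<^sup>2 = (norm (x + y))\<^sup>2 / 4"
      by (simp add: power_divide)
    then have "g x + g y - 2 * g ((1/2) *\<^sub>R (x + y)) = (norm (x - y))\<^sup>2 / 4"
      by (simp add: g_def f.scaleR f.add power2_norm_eq_inner inner_simps inner_commute field_simps)
    with m_le[of "(1/2) *\<^sub>R (x + y)"] show ?thesis by (simp add: field_simps)
  qed
  have "Cauchy X"
  proof (rule metric_CauchyI)
    fix e :: real assume e: "0 < e"
    obtain N where N: "inverse (real (Suc N)) < e\<^sup>2 / 8"
      using reals_Archimedean[of "e\<^sup>2 / 8"] e by auto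
    have small: "g (X n) - m < e\<^sup>2 / 8" if "n \<ge> N" for n
    proof -
      have "inverse (real (Suc n)) \<le> inverse (real (Suc N))"
        using that by (intro le_imp_inverse_le) auto
      then show ?thesis using X[of n] N by linarith
    qed
    have "dist (X i) (X j) < e" if "i \<ge> N" "j \<ge> N" for i j
    proof -
      have "(norm (X i - X j))\<^sup>2 < e\<^sup>2"
        using par[of "X i" "X j"] small[OF that(1)] small[OF that(2)] by (simp add: field_simps)
      then show ?thesis using e by (simp add: dist_norm power2_less_imp_less)
    qed
    then show "\<exists>N. \<forall>i\<ge>N. \<forall>j\<ge>N. dist (X i) (X j) < e" by blast
  qed
  then obtain v where v: "X \<longlonglongrightarrow> v" using Cauchy_convergent convergent_def by blast
  have "(\<lambda>n. g (X n)) \<longlonglongrightarrow> g v"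
    unfolding g_def by (intro tendsto_intros v f.tendsto) auto
  moreover have "(\<lambda>n. m + inverse (real (Suc n))) \<longlonglongrightarrow> m + 0"
    by (intro tendsto_intros LIMSEQ_inverse_real_of_nat)
  ultimately have "g v \<le> m + 0"
    by (rule LIMSEQ_le) (use X in \<open>auto intro: less_imp_le\<close>)
  then have gv: "g v \<le> g x" for x using m_le[of x] by simp
  have "f x = inner x v" for x
  proof (rule ccontr)
    assume "f x \<noteq> inner x v"
    define d where "d = f x - inner x v"
    have d: "d \<noteq> 0" using \<open>f x \<noteq> inner x v\<close> by (simp add: d_def)
    define q where "q = (norm x)\<^sup>2"
    have q: "q \<ge> 0" by (simp add: q_def)
    define t where "t = d / (1 + q)"
    have "(norm (v + t *\<^sub>R x))\<^sup>2 = (norm v)\<^sup>2 + 2 * t * inner x v + t\<^sup>2 * (norm x)\<^sup>2"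
      unfolding power2_norm_eq_inner
      by (simp add: inner_simps inner_commute[of v x] power2_eq_square algebra_simps
          del: dot_square_norm)
    then have "g (v + t *\<^sub>R x) - g v = t\<^sup>2 * q / 2 - t * d"
      by (simp add: g_def q_def d_def f.add f.scaleR field_simps)
    also have "\<dots> = - (d\<^sup>2 / (1 + q)) * (1 - q / (2 * (1 + q)))"
    proof -
      have "1 + q \<noteq> 0" using q by simp
      then have "t * (1 + q) = d" by (simp add: t_def)
      then have "t\<^sup>2 * (1 + q) = t * d" "d\<^sup>2 / (1 + q) = t * d"
        by (auto simp: power2_eq_square t_def)
      moreover have "t * d * (q / (2 * (1 + q))) = t\<^sup>2 * q / 2"
        unfolding calculation(1)[symmetric] using q by (simp add: divide_simps)
      ultimately show ?thesis by (simp add: right_diff_distrib)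
    qed
    also have "\<dots> < 0"
      using q d by (intro mult_neg_pos) (auto simp: field_simps)
    finally show False using gv[of "v + t *\<^sub>R x"] by simp
  qed
  then show ?thesis by blast
qed

lemma cinner_diff_right:
  "cinner x (y - z) = cinner x y - cinner x (z::'a::chilbert_space)"
proof -
  have "cinner x (y - z) + cinner x z = cinner x y"
    using cinner_commute[of x "y - z"] cinner_commute[of x z] cinner_commute[of x y]
      cinner_add_left[of "y - z" z x] by simp
  then show ?thesis by (simp add: eq_diff_eq)
qed

lemma cadjoint_ex1:
  fixes A :: "'a::chilbert_space \<Rightarrow> 'a"
  assumes "bounded_clinear A"
  shows "\<exists>!B. \<forall>x y. cinner (A x) y = cinner x (B y)"
proof -
  have lin: "bounded_linear A" and Ai: "A (c *\<^sub>C x) = c *\<^sub>C A x" for c x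
    using assms by (auto simp: bounded_clinear_def)
  have "\<exists>v. \<forall>x. inner (A x) y = inner x v" for y
    by (rule riesz_representation_real)
      (intro bounded_linear_compose[OF bounded_linear_inner_left lin])
  then obtain B where B: "\<And>x y. inner (A x) y = inner x (B y)" by metis
  have Re: "Re (cinner (A x) y) = Re (cinner x (B y))" for x y
    using B[of x y] by (simp add: inner_eq_Re_cinner)
  have "cinner (A x) y = cinner x (B y)" for x y
    using Re[of x y] Re[of "\<i> *\<^sub>C x" y] by (simp add: Ai cinner_scaleC_left complex_eq_iff)
  moreover have "C = B" if "\<forall>x y. cinner (A x) y = cinner x (C y)" for C
  proof
    fix y
    have "cinner (C y - B y) (C y - B y) = 0"
      using that calculation by (metis cinner_diff_right right_minus_eq)
    then have "inner (C y - B y) (C y - B y) = 0" by (simp add: inner_eq_Re_cinner)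
    then show "C y = B y" by simp
  qed
  ultimately show ?thesis by blast
qed

lemma cinner_cadjoint:
  assumes "bounded_clinear A"
  shows "cinner (A x) y = cinner x (cadjoint A y)"
  using theI'[OF cadjoint_ex1[OF assms]] unfolding cadjoint_def by blast

end

theory Submission
  imports Defs
begin

text \<open>Put $c = 1 - 1/\rho$. Completing the square shows that the operator in the theorem is positive
  exactly if
  \[ \|Ax\| \le \rho\,\|x - c\bar{z}Ax\| \quad\mbox{for all } x, \]
  the \<open>resolvent estimate\<close> below. Both it and the existence of a dilation are compared with a
  statement about sequences $g_0, \dots, g_m$ in $H$, the \<open>dilation_inequality\<close>
  \[ \sum_{j<m} \|Ag_j\|^2 \le \rho^2\Big(\|g_0\|^2 + \sum_{j<m} \|g_{j+1} - cAg_j\|^2\Big). \]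

  A $\rho$-dilation exists if and only if the Toeplitz kernel with entries $1$ on the diagonal,
  $A^n/\rho$ on the $n$-th diagonal below and $A^{*n}/\rho$ above is positive definite: a dilation $U$
  represents its quadratic form as a square norm $\|\sum_j U^jv_j\|^2$, and conversely the space is the
  completion of the finitely supported sequences under the form, with the bilateral shift for $U$. In
  the variables $g_j = \sum_{i\le j} A^{j-i}v_i$, so that $v_{j+1} = g_{j+1} - Ag_j$, the Toeplitz form
  becomes a sum of terms that involve two consecutive $g_j$ only
  (\<open>toeplitz_form_eq_energy\<close>), and the identity \<open>energy_eq\<close> turns its positivity into the dilation
  inequality.

  Passing from the dilation inequality to the resolvent estimate at a point $|z| < 1$ takes the
  sequence $z^Nx, \dots, zx, x, cAx$: it makes every difference a multiple of $x - czAx$, and the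
  geometric factors on both sides cancel as $N \to \infty$.

  The converse is a Fourier argument. For $g_m = 0$ the dilation inequality is the integral over the
  unit circle of the resolvent estimate at the Fourier transform of $g$; sums over roots of unity
  suffice. A general sequence is continued by $g_{m+n} = (cA)^n g_m$, which costs nothing except a
  term $\|(cA)^{n+1}g_m\|^2$ at the place where it is cut off. So it remains to see that
  $(cA)^n x \to 0$ (\<open>resolvent_estimate_imp_powers_decay\<close>). Here the resolvent estimate is used in the
  whole disk: for $t \le c$ the Fourier argument applied to the sequences $t^jA^jx$ bounds
  $\sum_{1\le j\le n} t^{2j}\|A^jx\|^2$ by a constant multiple of $\|x\|^2 + t^{2n}\|A^nx\|^2$, so that
  these sums are either bounded or grow exponentially at a definite rate; this excludes growth just
  above a $t$ for which they are bounded, and $t$ can be raised step by step up to $c$.\<close>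

section \<open>Complex Hilbert spaces\<close>

lemma cinner_add_right: "cinner x (y + z) = cinner x y + cinner x (z::'a::chilbert_space)"
  using cinner_commute[of x "y + z"] cinner_commute[of x z] cinner_commute[of x y]
    cinner_add_left[of y z x] by simp

lemma cinner_diff_left: "cinner (x - y) z = cinner x z - cinner y (z::'a::chilbert_space)"
  using cinner_add_left[of "x - y" y z] by (simp add: eq_diff_eq)

lemma cinner_scaleC_right: "cinner x (c *\<^sub>C y) = cnj c * cinner x (y::'a::chilbert_space)"
  using cinner_commute[of x "c *\<^sub>C y"] cinner_commute[of x y] cinner_scaleC_left[of c y x]
  by simp

lemma cinner_zero [simp]:
  "cinner 0 (x::'a::chilbert_space) = 0" "cinner (x::'a) 0 = 0"
  using cinner_add_left[of 0 0 x] cinner_add_right[of x 0 0] by simp_all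

lemma cinner_sum_left:
  "cinner (\<Sum>i\<in>I. f i) (x::'a::chilbert_space) = (\<Sum>i\<in>I. cinner (f i) x)"
  by (induction I rule: infinite_finite_induct) (simp_all add: cinner_add_left)

lemma cinner_sum_right:
  "cinner (x::'a::chilbert_space) (\<Sum>i\<in>I. f i) = (\<Sum>i\<in>I. cinner x (f i))"
  by (induction I rule: infinite_finite_induct) (simp_all add: cinner_add_right)

lemma cinner_self: "cinner x x = complex_of_real ((norm (x::'a::chilbert_space))\<^sup>2)"
proof -
  have "Im (cinner x x) = 0"
    using arg_cong[OF cinner_commute[of x x], of Im] by simp
  then show ?thesis
    by (simp add: complex_eq_iff power2_norm_eq_inner inner_eq_Re_cinner del: of_real_power)
qed

lemma cinner_scaleR_left: "cinner (r *\<^sub>R x) y = of_real r * cinner x (y::'a::chilbert_space)"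
  by (simp add: scaleR_scaleC cinner_scaleC_left)

lemma norm_diff_square:
  "(norm (x - y))\<^sup>2 = (norm x)\<^sup>2 - 2 * inner x y + (norm (y::'a::real_inner))\<^sup>2"
  using dot_norm_neg[of x y] by (simp add: field_simps)

lemma norm_scaleC: "norm (c *\<^sub>C x) = cmod c * norm (x::'a::chilbert_space)"
proof -
  have "complex_of_real ((norm (c *\<^sub>C x))\<^sup>2) = c * cnj c * cinner x x"
    by (simp only: cinner_self[symmetric] cinner_scaleC_left cinner_scaleC_right ac_simps)
  also have "\<dots> = complex_of_real ((cmod c * norm x)\<^sup>2)"
    by (simp only: complex_norm_square[symmetric] cinner_self power_mult_distrib of_real_mult)
  finally have "(norm (c *\<^sub>C x))\<^sup>2 = (cmod c * norm x)\<^sup>2"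
    by (simp only: of_real_eq_iff)
  then show ?thesis by simp
qed

lemma scaleC_sum_right:
  "c *\<^sub>C (\<Sum>i\<in>I. f i) = (\<Sum>i\<in>I. c *\<^sub>C (f i :: 'a::complex_vector))"
  by (induction I rule: infinite_finite_induct) (simp_all add: scaleC_add_right scaleC_zero_right)

lemma scaleC_diff_right: "c *\<^sub>C (x - y) = c *\<^sub>C x - c *\<^sub>C (y::'a::complex_vector)"
  using scaleC_add_right[of c "x - y" y] by (simp add: eq_diff_eq)

lemma scaleR_scaleC_swap: "r *\<^sub>R c *\<^sub>C x = c *\<^sub>C r *\<^sub>R (x::'a::chilbert_space)"
  by (simp add: scaleR_scaleC scaleC_scaleC mult.commute)

lemma bounded_clinear_linear: "bounded_clinear A \<Longrightarrow> linear A"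
  by (simp add: bounded_clinear_def bounded_linear.linear)

lemma bounded_clinear_scaleC: "bounded_clinear A \<Longrightarrow> A (c *\<^sub>C x) = c *\<^sub>C A x"
  by (simp add: bounded_clinear_def)


section \<open>The condition as a resolvent estimate\<close>

text \<open>With $c = 1 - 1/\rho$, the quadratic form of the operator is
  $\|x - c\bar{z}Ax\|^2 - \|Ax\|^2/\rho^2$.\<close>

lemma positive_op_iff_resolvent_estimate:
  fixes A :: "'a::chilbert_space \<Rightarrow> 'a"
  assumes A: "bounded_clinear A" and \<rho>: "\<rho> \<ge> 1"
  shows "positive_op (\<lambda>x.
        x - (2 * (1 - 1 / \<rho>)) *\<^sub>R Re_op (\<lambda>y. cnj z *\<^sub>C A y) x
          - (1 / \<rho>\<^sup>2 - (1 - 1 / \<rho>)\<^sup>2 * (cmod z)\<^sup>2) *\<^sub>R cadjoint A (A x))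
    \<longleftrightarrow> (\<forall>x. norm (A x) \<le> \<rho> * norm (x - (1 - 1 / \<rho>) *\<^sub>R cnj z *\<^sub>C A x))"
    (is "positive_op ?T \<longleftrightarrow> _")
proof -
  define c where "c = 1 - 1 / \<rho>"
  define B where "B = (\<lambda>y. cnj z *\<^sub>C A y)"
  have "bounded_linear (\<lambda>y. cnj z *\<^sub>C y :: 'a)"
    by (rule bounded_linear_intro[of _ "cmod z"])
      (simp_all add: scaleC_add_right scaleR_scaleC scaleC_scaleC norm_scaleC mult.commute)
  then have B: "bounded_clinear B"
    using A bounded_linear_compose[of "\<lambda>y. cnj z *\<^sub>C y" A]
    by (simp add: bounded_clinear_def B_def scaleC_scaleC mult.commute)
  have adj: "cinner (cadjoint T x) y = cinner x (T y)" if "bounded_clinear T" for T :: "'a \<Rightarrow> 'a" and x y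
    using cinner_cadjoint[OF that, of y x] cinner_commute[of "cadjoint T x" y]
      cinner_commute[of x "T y"] by simp
  have quad: "cinner (?T x) x
      = of_real ((norm (x - c *\<^sub>R B x))\<^sup>2 - (norm (A x))\<^sup>2 / \<rho>\<^sup>2)" for x
  proof -
    have Re: "cinner (Re_op B x) x = of_real (inner (B x) x)"
      using cinner_commute[of x "B x"]
      by (simp add: Re_op_def cinner_scaleR_left cinner_add_left adj[OF B] inner_eq_Re_cinner
          complex_eq_iff)
    have "cinner (?T x) x = of_real ((norm x)\<^sup>2 - 2 * c * inner (B x) x
        - (1 / \<rho>\<^sup>2 - c\<^sup>2 * (cmod z)\<^sup>2) * (norm (A x))\<^sup>2)"
      unfolding cinner_diff_left cinner_scaleR_left B_def[symmetric] Re adj[OF A] cinner_self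
      by (simp add: c_def)
    also have "(norm x)\<^sup>2 - 2 * c * inner (B x) x - (1 / \<rho>\<^sup>2 - c\<^sup>2 * (cmod z)\<^sup>2) * (norm (A x))\<^sup>2
      = (norm (x - c *\<^sub>R B x))\<^sup>2 - (norm (A x))\<^sup>2 / \<rho>\<^sup>2"
    proof -
      have "(norm (x - c *\<^sub>R B x))\<^sup>2 = (norm x)\<^sup>2 - 2 * c * inner (B x) x + c\<^sup>2 * (norm (B x))\<^sup>2"
        by (simp add: norm_diff_square inner_commute[of x] power_mult_distrib)
      moreover have "norm (B x) = cmod z * norm (A x)" by (simp add: B_def norm_scaleC)
      ultimately show ?thesis by (simp add: algebra_simps power_mult_distrib)
    qed
    finally show ?thesis .
  qed
  have "0 \<le> (norm (x - c *\<^sub>R B x))\<^sup>2 - (norm (A x))\<^sup>2 / \<rho>\<^sup>2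
      \<longleftrightarrow> norm (A x) \<le> \<rho> * norm (x - c *\<^sub>R B x)" for x
  proof -
    have "0 \<le> (norm (x - c *\<^sub>R B x))\<^sup>2 - (norm (A x))\<^sup>2 / \<rho>\<^sup>2
        \<longleftrightarrow> (norm (A x))\<^sup>2 \<le> (\<rho> * norm (x - c *\<^sub>R B x))\<^sup>2"
      using \<rho> by (simp add: divide_simps power_mult_distrib mult.commute)
    then show ?thesis using \<rho> by (simp add: power2_le_iff_abs_le)
  qed
  then show ?thesis
    unfolding positive_op_def quad by (simp add: c_def B_def del: of_real_diff)
qed

section \<open>From the symbol to sequences\<close>

lemma sum_roots_of_unity_orthogonal:
  fixes N i j :: nat
  assumes "i < N" "j < N"
  defines "\<omega> \<equiv> cis (2 * pi / real N)"
  shows "(\<Sum>k<N. (\<omega> ^ k) ^ i * cnj ((\<omega> ^ k) ^ j)) = (if i = j then of_nat N else 0)"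
proof -
  define \<eta> where "\<eta> = \<omega> ^ i * cnj (\<omega> ^ j)"
  have \<omega>: "\<omega> * cnj \<omega> = 1" by (simp add: \<omega>_def cis_cnj cis_mult)
  have unit: "\<omega> ^ j * cnj (\<omega> ^ j) = 1" using \<omega> by (simp flip: power_mult_distrib)
  have "(\<Sum>k<N. (\<omega> ^ k) ^ i * cnj ((\<omega> ^ k) ^ j)) = (\<Sum>k<N. \<eta> ^ k)"
    by (simp add: \<eta>_def power_mult_distrib mult.commute flip: power_mult)
  also have "\<dots> = (if i = j then of_nat N else 0)"
  proof (cases "i = j")
    case True
    then have "\<eta> = 1" using unit by (simp add: \<eta>_def)
    then show ?thesis using True by simp
  next
    case False
    have pow: "\<omega> ^ l = cis (2 * pi * real l / real N)" for l
      by (simp add: \<omega>_def Complex.DeMoivre mult.commute)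
    have "inj_on (\<lambda>l. \<omega> ^ l) {..<N}"
      using Complex.bij_betw_roots_unity[of N] assms(1) by (simp add: pow bij_betw_def)
    then have "\<omega> ^ i \<noteq> \<omega> ^ j" using False assms(1,2) by (auto dest: inj_onD)
    have "\<eta> \<noteq> 1"
    proof
      assume "\<eta> = 1"
      have "\<omega> ^ i = \<omega> ^ i * (\<omega> ^ j * cnj (\<omega> ^ j))" by (simp only: unit mult_1_right)
      also have "\<dots> = \<omega> ^ j * \<eta>" unfolding \<eta>_def by (rule mult.left_commute)
      finally show False using \<open>\<eta> = 1\<close> \<open>\<omega> ^ i \<noteq> \<omega> ^ j\<close> by simp
    qed
    moreover have "\<omega> ^ N = 1" using assms(1) by (simp add: pow)
    moreover have "\<eta> ^ N = (\<omega> ^ N) ^ i * cnj (\<omega> ^ N) ^ j"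
      by (simp add: \<eta>_def power_mult_distrib mult.commute flip: power_mult)
    ultimately show ?thesis using False by (simp add: geometric_sum)
  qed
  finally show ?thesis .
qed

lemma discrete_parseval:
  fixes f :: "nat \<Rightarrow> 'a::chilbert_space" and N :: nat
  defines "\<omega> \<equiv> cis (2 * pi / real N)"
  shows "(\<Sum>k<N. (norm (\<Sum>j<N. (\<omega> ^ k) ^ j *\<^sub>C f j))\<^sup>2) = real N * (\<Sum>j<N. (norm (f j))\<^sup>2)"
proof -
  have "complex_of_real (\<Sum>k<N. (norm (\<Sum>j<N. (\<omega> ^ k) ^ j *\<^sub>C f j))\<^sup>2)
      = (\<Sum>k<N. \<Sum>i<N. \<Sum>j<N. ((\<omega> ^ k) ^ i * cnj ((\<omega> ^ k) ^ j)) * cinner (f i) (f j))"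
    unfolding of_real_sum cinner_self[symmetric] cinner_sum_left
    by (simp add: cinner_sum_right cinner_scaleC_left cinner_scaleC_right sum_distrib_left
        mult.assoc mult.left_commute del: complex_cnj_power)
  also have "\<dots> = (\<Sum>i<N. \<Sum>j<N. (\<Sum>k<N. (\<omega> ^ k) ^ i * cnj ((\<omega> ^ k) ^ j)) * cinner (f i) (f j))"
    by (subst sum.swap, rule sum.cong[OF refl], subst sum.swap) (simp add: sum_distrib_right)
  also have "\<dots> = (\<Sum>i<N. \<Sum>j<N. (if i = j then of_nat N else 0) * cinner (f i) (f j))"
    unfolding \<omega>_def
    by (intro sum.cong refl arg_cong2[of _ _ _ _ "(*)"] sum_roots_of_unity_orthogonal) auto
  also have "\<dots> = (\<Sum>i<N. of_nat N * cinner (f i) (f i))"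
    by (simp add: if_distrib[of "\<lambda>x. x * _"] cong: if_cong)
  also have "\<dots> = complex_of_real (real N * (\<Sum>j<N. (norm (f j))\<^sup>2))"
    by (simp add: cinner_self sum_distrib_left)
  finally show ?thesis by (simp only: of_real_eq_iff)
qed

text \<open>The transform $\hat g(\zeta) = \sum_j \zeta^jg_j$ turns the difference $g_{j+1} - Cg_j$ into
  $\hat g(\zeta) - \zeta C\hat g(\zeta)$. Since only finitely many terms are involved, Parseval's identity over
  sufficiently many roots of unity adds up the pointwise estimates without any integral.\<close>

lemma symbol_estimate_imp_finite_sequence_estimate:
  fixes B C :: "'a::chilbert_space \<Rightarrow> 'a"
  assumes B: "bounded_clinear B" and C: "bounded_clinear C"
    and est: "\<And>\<zeta> x. cmod \<zeta> = 1 \<Longrightarrow> norm (B x) \<le> M * norm (x - \<zeta> *\<^sub>C C x)"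
    and end0: "g n = 0"
  shows "(\<Sum>j<n. (norm (B (g j)))\<^sup>2)
    \<le> M\<^sup>2 * ((norm (g 0))\<^sup>2 + (\<Sum>j<n. (norm (g (Suc j) - C (g j)))\<^sup>2))"
proof -
  \<comment> \<open>the last difference has index \<open>n\<close>, so \<open>Suc n\<close> roots of unity separate all coefficients\<close>
  define N where "N = Suc n"
  define h where "h j = (case j of 0 \<Rightarrow> g 0 | Suc i \<Rightarrow> g j - C (g i))" for j
  define \<omega> where "\<omega> = cis (2 * pi / real N)"
  interpret B: linear B using B by (rule bounded_clinear_linear)
  interpret C: linear C using C by (rule bounded_clinear_linear)
  have transform: "(\<Sum>j<N. \<zeta> ^ j *\<^sub>C h j) = (\<Sum>j<N. \<zeta> ^ j *\<^sub>C g j) - \<zeta> *\<^sub>C C (\<Sum>j<N. \<zeta> ^ j *\<^sub>C g j)"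
    for \<zeta>
  proof -
    have "(\<Sum>j<N. \<zeta> ^ j *\<^sub>C h j)
        = g 0 + (\<Sum>j<n. \<zeta> ^ Suc j *\<^sub>C g (Suc j)) - (\<Sum>j<n. \<zeta> ^ Suc j *\<^sub>C C (g j))"
      unfolding N_def sum.lessThan_Suc_shift
      by (simp add: h_def scaleC_one scaleC_diff_right sum_subtractf)
    also have "g 0 + (\<Sum>j<n. \<zeta> ^ Suc j *\<^sub>C g (Suc j)) = (\<Sum>j<N. \<zeta> ^ j *\<^sub>C g j)"
      unfolding N_def sum.lessThan_Suc_shift by (simp add: scaleC_one)
    also have "(\<Sum>j<n. \<zeta> ^ Suc j *\<^sub>C C (g j)) = \<zeta> *\<^sub>C C (\<Sum>j<N. \<zeta> ^ j *\<^sub>C g j)"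
      by (simp add: N_def end0 scaleC_zero_right C.sum scaleC_sum_right scaleC_scaleC
          bounded_clinear_scaleC[OF C])
    finally show ?thesis .
  qed
  have unit: "cmod (\<omega> ^ k) = 1" for k by (simp add: \<omega>_def norm_power)
  have "real N * (\<Sum>j<N. (norm (B (g j)))\<^sup>2)
      = (\<Sum>k<N. (norm (B (\<Sum>j<N. (\<omega> ^ k) ^ j *\<^sub>C g j)))\<^sup>2)"
    unfolding \<omega>_def by (simp add: B.sum bounded_clinear_scaleC[OF B] flip: discrete_parseval)
  also have "\<dots> \<le> (\<Sum>k<N. M\<^sup>2 * (norm (\<Sum>j<N. (\<omega> ^ k) ^ j *\<^sub>C h j))\<^sup>2)"
    unfolding transform
    by (intro sum_mono)
      (simp add: power_mono[OF est[OF unit] norm_ge_zero] flip: power_mult_distrib)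
  also have "\<dots> = real N * (M\<^sup>2 * (\<Sum>j<N. (norm (h j))\<^sup>2))"
    unfolding \<omega>_def sum_distrib_left[symmetric] discrete_parseval by simp
  finally have "(\<Sum>j<N. (norm (B (g j)))\<^sup>2) \<le> M\<^sup>2 * (\<Sum>j<N. (norm (h j))\<^sup>2)"
    by (simp add: N_def)
  moreover have "(\<Sum>j<N. (norm (B (g j)))\<^sup>2) = (\<Sum>j<n. (norm (B (g j)))\<^sup>2)"
    by (simp add: N_def end0 B.zero)
  moreover have "(\<Sum>j<N. (norm (h j))\<^sup>2)
      = (norm (g 0))\<^sup>2 + (\<Sum>j<n. (norm (g (Suc j) - C (g j)))\<^sup>2)"
    unfolding N_def sum.lessThan_Suc_shift by (simp add: h_def)
  ultimately show ?thesis by simp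
qed

section \<open>Decay of powers\<close>

text \<open>Write $S_n$ for the sum and $\theta = 1 - 1/C$. The last hypothesis at \<open>Suc n\<close>, in which
  $t^{n+1}\beta_{n+1} = S_{n+1} - S_n$, says that $S_n - C\beta_0 \le \theta\,(S_{n+1} - C\beta_0)$. So
  $S_n - C\beta_0$, once positive, grows at least like $\theta^{-n}$; but it grows at most like
  $n\,(t/s)^n$, and $t/s < 1/\theta$.\<close>

lemma weighted_sum_bound_enlarge_weight:
  fixes \<beta> :: "nat \<Rightarrow> real"
  assumes nonneg: "\<And>n. 0 \<le> \<beta> n" and C: "C > 1"
    and s: "0 < s" "s \<le> t" "t * (1 - 1 / C) < s"
    and bounded: "\<And>n. s ^ n * \<beta> n \<le> B"
    and ineq: "\<And>n. (\<Sum>j<n. t ^ Suc j * \<beta> (Suc j)) \<le> C * (\<beta> 0 + t ^ n * \<beta> n)"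
  shows "(\<Sum>j<n. t ^ Suc j * \<beta> (Suc j)) \<le> C * \<beta> 0"
proof -
  define \<theta> where "\<theta> = 1 - 1 / C"
  define S where "S n = (\<Sum>j<n. t ^ Suc j * \<beta> (Suc j))" for n
  have \<theta>: "0 \<le> \<theta>" "\<theta> < 1" using C by (auto simp: \<theta>_def)
  have step: "S k - C * \<beta> 0 \<le> \<theta> * (S (Suc k) - C * \<beta> 0)" for k
  proof -
    have "S (Suc k) \<le> C * (\<beta> 0 + (S (Suc k) - S k))"
      using ineq[of "Suc k"] by (simp add: S_def)
    then have "S (Suc k) / C \<le> \<beta> 0 + (S (Suc k) - S k)"
      using C by (simp add: pos_divide_le_eq mult.commute)
    then show ?thesis using C by (simp add: \<theta>_def algebra_simps)
  qed
  have iterate: "S k - C * \<beta> 0 \<le> \<theta> ^ n * (S (k + n) - C * \<beta> 0)" for k n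
  proof (induction n)
    case (Suc n)
    have "\<theta> ^ n * (S (k + n) - C * \<beta> 0) \<le> \<theta> ^ n * (\<theta> * (S (Suc (k + n)) - C * \<beta> 0))"
      using step \<theta> by (intro mult_left_mono) auto
    with Suc show ?case by (simp add: mult.assoc mult.left_commute)
  qed simp
  define q where "q = t / s"
  have q: "1 \<le> q" using s by (simp add: q_def)
  have S_le: "S n \<le> real n * (B * q ^ n)" for n
  proof -
    have "t ^ Suc j * \<beta> (Suc j) \<le> B * q ^ n" if "j < n" for j
    proof -
      have "t ^ Suc j * \<beta> (Suc j) = q ^ Suc j * (s ^ Suc j * \<beta> (Suc j))"
        using s by (simp add: q_def power_divide)
      also have "\<dots> \<le> q ^ n * B"
      proof (rule mult_mono)
        show "q ^ Suc j \<le> q ^ n" using q that by (intro power_increasing) auto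
      qed (use bounded[of "Suc j"] nonneg[of "Suc j"] q s in simp_all)
      finally show ?thesis by (simp add: mult.commute)
    qed
    then have "S n \<le> (\<Sum>j<n. B * q ^ n)" unfolding S_def by (intro sum_mono) auto
    then show ?thesis by simp
  qed
  have "S k - C * \<beta> 0 \<le> 0" for k
  proof (rule LIMSEQ_le_const)
    define \<phi> where "\<phi> = \<theta> * q"
    have \<phi>: "norm \<phi> < 1"
      using \<theta> q s by (auto simp: \<phi>_def q_def \<theta>_def abs_mult divide_simps mult.commute)
    show "\<exists>N. \<forall>n\<ge>N. S k - C * \<beta> 0
        \<le> real k * B * q ^ k * \<phi> ^ n + B * q ^ k * (real n * \<phi> ^ n) - \<theta> ^ n * (C * \<beta> 0)"
    proof (intro exI allI impI)
      fix n
      have "\<theta> ^ n * S (k + n) \<le> \<theta> ^ n * (real (k + n) * (B * q ^ (k + n)))"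
        by (rule mult_left_mono[OF S_le]) (use \<theta> in simp)
      also have "\<dots> = real k * B * q ^ k * \<phi> ^ n + B * q ^ k * (real n * \<phi> ^ n)"
        by (simp add: \<phi>_def power_add power_mult_distrib algebra_simps)
      finally show "S k - C * \<beta> 0
        \<le> real k * B * q ^ k * \<phi> ^ n + B * q ^ k * (real n * \<phi> ^ n) - \<theta> ^ n * (C * \<beta> 0)"
        using iterate[of k n] by (simp add: right_diff_distrib)
    qed
    have "(\<lambda>n. real k * B * q ^ k * \<phi> ^ n + B * q ^ k * (real n * \<phi> ^ n) - \<theta> ^ n * (C * \<beta> 0))
        \<longlonglongrightarrow> real k * B * q ^ k * 0 + B * q ^ k * 0 - 0 * (C * \<beta> 0)"
      using \<phi> \<theta> by (intro tendsto_intros LIMSEQ_power_zero powser_times_n_limit_0) auto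
    then show "(\<lambda>n. real k * B * q ^ k * \<phi> ^ n + B * q ^ k * (real n * \<phi> ^ n) - \<theta> ^ n * (C * \<beta> 0))
        \<longlonglongrightarrow> 0" by simp
  qed
  then show ?thesis by (simp add: S_def)
qed

text \<open>The ratio by which the preceding lemma may raise the weight depends on \<open>C\<close> only. Starting from the
  trivial weight \<open>1 / L\<close>, finitely many such steps reach \<open>r\<close>.\<close>

lemma weighted_sum_bound:
  fixes \<beta> :: "nat \<Rightarrow> real"
  assumes nonneg: "\<And>n. 0 \<le> \<beta> n" and C: "C > 1" and r: "r > 0" and L: "L > 0"
    and growth: "\<And>n. \<beta> n \<le> B * L ^ n"
    and ineq: "\<And>t n. 0 \<le> t \<Longrightarrow> t \<le> r \<Longrightarrow>
      (\<Sum>j<n. t ^ Suc j * \<beta> (Suc j)) \<le> C * (\<beta> 0 + t ^ n * \<beta> n)"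
  shows "(\<Sum>j<n. r ^ Suc j * \<beta> (Suc j)) \<le> C * \<beta> 0"
proof -
  define \<theta> where "\<theta> = 1 - 1 / C"
  have \<theta>: "0 \<le> \<theta>" "\<theta> < 1" using C by (auto simp: \<theta>_def)
  \<comment> \<open>any ratio strictly between \<open>1\<close> and \<open>1 / \<theta>\<close> would do\<close>
  define q where "q = 2 / (1 + \<theta>)"
  have q: "1 < q" "q * \<theta> < 1" "0 < q" using \<theta> by (auto simp: q_def field_simps)
  define w where "w k = min (1 / L * q ^ k) r" for k
  have w_pos: "0 < w k" for k using L r q by (simp add: w_def)
  have "\<exists>B. \<forall>n. w k ^ n * \<beta> n \<le> B" for k
  proof (induction k)
    case 0
    have "w 0 ^ n * \<beta> n \<le> B" for n
    proof -
      have "w 0 ^ n * \<beta> n \<le> (1 / L) ^ n * (B * L ^ n)"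
        using w_pos[of 0] growth nonneg L
        by (intro mult_mono power_mono) (auto simp: w_def)
      then show ?thesis using L by (simp add: power_divide)
    qed
    then show ?case by blast
  next
    case (Suc k)
    then obtain B where B: "\<And>n. w k ^ n * \<beta> n \<le> B" by blast
    have mono: "w k \<le> w (Suc k)" 
      using q L by (auto simp: w_def min_le_iff_disj divide_right_mono)
    have "r \<le> q * r" using q r by simp
    then have "w (Suc k) \<le> q * w k" by (auto simp: w_def min_def)
    then have "w (Suc k) * \<theta> \<le> q * w k * \<theta>" using \<theta> by (intro mult_right_mono)
    also have "\<dots> = (q * \<theta>) * w k" by simp
    also have "\<dots> < 1 * w k" using q w_pos by (intro mult_strict_right_mono)
    finally have lt: "w (Suc k) * (1 - 1 / C) < w k" by (simp add: \<theta>_def)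
    have bd: "(\<Sum>j<n. w (Suc k) ^ Suc j * \<beta> (Suc j)) \<le> C * \<beta> 0" for n
      by (rule weighted_sum_bound_enlarge_weight[OF nonneg C w_pos mono lt B])
        (use ineq w_pos[of "Suc k"] in \<open>auto simp: w_def\<close>)
    have "w (Suc k) ^ n * \<beta> n \<le> C * \<beta> 0" for n
    proof (cases n)
      case 0
      then show ?thesis using C nonneg[of 0] mult_right_mono[of 1 C "\<beta> 0"] by simp
    next
      case (Suc i)
      have "0 \<le> (\<Sum>j<i. w (Suc k) ^ Suc j * \<beta> (Suc j))"
        using nonneg w_pos[of "Suc k"] by (intro sum_nonneg mult_nonneg_nonneg) auto
      then show ?thesis using bd[of n] Suc by simp
    qed
    then show ?case by blast
  qed
  moreover obtain k where "r * L < q ^ k" using real_arch_pow[OF q(1)] by blast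
  then have "w k = r" using L by (simp add: w_def divide_simps mult.commute)
  ultimately obtain B' where "\<And>n. r ^ n * \<beta> n \<le> B'" by metis
  moreover have "r * (1 - 1 / C) < r" using r C by simp
  ultimately show ?thesis
    using weighted_sum_bound_enlarge_weight[OF nonneg C r order.refl] ineq r by fastforce
qed

lemma bounded_clinear_scaleR:
  "bounded_clinear A \<Longrightarrow> bounded_clinear (\<lambda>x. t *\<^sub>R A x)"
  by (auto simp: bounded_clinear_def scaleR_scaleC_swap intro: bounded_linear_scaleR_right
      bounded_linear_compose)

text \<open>With $t = \tau^2$, the sequence $x, \tau Ax, \dots, \tau^{n-1}A^{n-1}x, 0$ has
  $g_{j+1} = \tau Ag_j$ except at its end. The Fourier estimate for it is the hypothesis of
  \<open>weighted_sum_bound\<close> for $\beta_j = \|A^jx\|^2$. At $t = c^2$ the sums $\sum_j c^{2j}\|A^jx\|^2$ are then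
  bounded, so their terms tend to $0$.\<close>

lemma resolvent_estimate_imp_powers_decay:
  fixes A :: "'a::chilbert_space \<Rightarrow> 'a"
  assumes A: "bounded_clinear A" and c: "0 \<le> c"
    and est: "\<And>z x. cmod z \<le> 1 \<Longrightarrow> norm (A x) \<le> M * norm (x - c *\<^sub>R z *\<^sub>C A x)"
  shows "(\<lambda>n. c ^ n * norm ((A ^^ n) x)) \<longlonglongrightarrow> 0"
proof (cases "c = 0")
  case True
  then show ?thesis
    by (intro tendsto_eventually eventually_sequentiallyI[of 1]) (simp add: power_0_left)
next
  case False
  with c have c: "c > 0" by simp
  interpret A: linear A using A by (rule bounded_clinear_linear)
  define \<beta> where "\<beta> n = (norm ((A ^^ n) x))\<^sup>2" for n
  obtain K where K: "K > 0" "\<And>y. norm (A y) \<le> norm y * K"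
    using A bounded_linear.pos_bounded[of A] by (auto simp: bounded_clinear_def)
  have "norm ((A ^^ n) x) \<le> norm x * K ^ n" for n
  proof (induction n)
    case (Suc n)
    have "norm (A ((A ^^ n) x)) \<le> norm ((A ^^ n) x) * K" by (rule K)
    also have "\<dots> \<le> norm x * K ^ n * K" using Suc K by (intro mult_right_mono) auto
    finally show ?case by (simp add: mult_ac)
  qed simp
  then have growth: "\<beta> n \<le> (norm x)\<^sup>2 * (K\<^sup>2) ^ n" for n
    unfolding \<beta>_def using power_mono[of "norm ((A ^^ n) x)" "norm x * K ^ n" 2]
    by (simp add: power_mult_distrib mult.commute flip: power_mult)
  have ineq: "(\<Sum>j<n. t ^ Suc j * \<beta> (Suc j)) \<le> (1 + c\<^sup>2 * M\<^sup>2) * (\<beta> 0 + t ^ n * \<beta> n)"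
    if t: "0 \<le> t" "t \<le> c\<^sup>2" for t n
  proof (cases n)
    case 0
    have "0 \<le> (1 + c\<^sup>2 * M\<^sup>2) * (\<beta> 0 + t ^ 0 * \<beta> 0)"
      by (intro mult_nonneg_nonneg add_nonneg_nonneg) (auto simp: \<beta>_def)
    then show ?thesis using 0 by simp
  next
    case (Suc i)
    define \<tau> where "\<tau> = sqrt t"
    have \<tau>: "0 \<le> \<tau>" "\<tau> \<le> c" "\<tau>\<^sup>2 = t"
      using t c by (auto simp: \<tau>_def real_le_lsqrt real_sqrt_le_iff intro: real_le_lsqrt)
    define g where "g j = (if j < n then \<tau> ^ j *\<^sub>R (A ^^ j) x else 0)" for j
    have symbol: "norm (A y) \<le> M * norm (y - \<zeta> *\<^sub>C (\<tau> *\<^sub>R A y))" if "cmod \<zeta> = 1" for \<zeta> y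
      using est[of "(\<tau> / c) * \<zeta>" y] that \<tau> c
      by (simp add: norm_mult norm_divide scaleR_scaleC scaleC_scaleC mult.commute)
    have "(\<Sum>j<n. (norm (A (g j)))\<^sup>2)
      \<le> M\<^sup>2 * ((norm (g 0))\<^sup>2 + (\<Sum>j<n. (norm (g (Suc j) - \<tau> *\<^sub>R A (g j)))\<^sup>2))"
      by (rule symbol_estimate_imp_finite_sequence_estimate[OF A bounded_clinear_scaleR[OF A] symbol])
        (auto simp: g_def)
    also have "(\<Sum>j<n. (norm (g (Suc j) - \<tau> *\<^sub>R A (g j)))\<^sup>2) = t ^ n * \<beta> n"
    proof -
      have "(\<Sum>j<i. (norm (g (Suc j) - \<tau> *\<^sub>R A (g j)))\<^sup>2) = 0"
        by (intro sum.neutral) (simp add: g_def Suc A.scaleR)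
      then show ?thesis
        using \<tau> by (simp add: Suc g_def A.scaleR \<beta>_def power_mult_distrib)
          (simp add: power_mult_distrib mult.commute flip: \<tau>(3) power_mult)
    qed
    also have "g 0 = x" by (simp add: g_def Suc)
    finally have main: "(\<Sum>j<n. (norm (A (g j)))\<^sup>2) \<le> M\<^sup>2 * (\<beta> 0 + t ^ n * \<beta> n)"
      by (simp add: \<beta>_def)
    have "(\<Sum>j<n. t ^ Suc j * \<beta> (Suc j)) = t * (\<Sum>j<n. (norm (A (g j)))\<^sup>2)"
      unfolding sum_distrib_left
      by (intro sum.cong refl)
        (use \<tau> in \<open>simp add: g_def A.scaleR \<beta>_def power_mult_distrib power_even_eq flip: \<tau>(3) power_mult\<close>)
    also have "\<dots> \<le> t * (M\<^sup>2 * (\<beta> 0 + t ^ n * \<beta> n))" using main t by (intro mult_left_mono)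
    also have "\<dots> = (t * M\<^sup>2) * (\<beta> 0 + t ^ n * \<beta> n)" by simp
    also have "\<dots> \<le> (1 + c\<^sup>2 * M\<^sup>2) * (\<beta> 0 + t ^ n * \<beta> n)"
      using t mult_right_mono[OF t(2), of "M\<^sup>2"]
      by (intro mult_right_mono) (auto simp: \<beta>_def)
    finally show ?thesis .
  qed
  \<comment> \<open>\<open>\<bar>M\<bar> + 1\<close> replaces \<open>M\<close> because the constant must exceed \<open>1\<close> also for \<open>M = 0\<close>\<close>
  have "(\<Sum>j<n. (c\<^sup>2) ^ Suc j * \<beta> (Suc j)) \<le> (1 + c\<^sup>2 * (\<bar>M\<bar> + 1)\<^sup>2) * \<beta> 0" for n
  proof (rule weighted_sum_bound[OF _ _ _ _ growth])
    fix t n assume t: "0 \<le> t" "t \<le> c\<^sup>2"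
    have "M\<^sup>2 \<le> (\<bar>M\<bar> + 1)\<^sup>2" by (simp add: power2_eq_square algebra_simps)
    then have "(1 + c\<^sup>2 * M\<^sup>2) * (\<beta> 0 + t ^ n * \<beta> n)
        \<le> (1 + c\<^sup>2 * (\<bar>M\<bar> + 1)\<^sup>2) * (\<beta> 0 + t ^ n * \<beta> n)"
      using t by (intro mult_right_mono add_left_mono mult_left_mono) (auto simp: \<beta>_def)
    with ineq[OF t] show "(\<Sum>j<n. t ^ Suc j * \<beta> (Suc j))
        \<le> (1 + c\<^sup>2 * (\<bar>M\<bar> + 1)\<^sup>2) * (\<beta> 0 + t ^ n * \<beta> n)" by (rule order.trans)
  qed (use c K in \<open>auto simp: \<beta>_def intro!: mult_pos_pos add_nonneg_pos\<close>)
  then have "summable (\<lambda>j. (c\<^sup>2) ^ Suc j * \<beta> (Suc j))"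
    by (intro summableI_nonneg_bounded) (auto simp: \<beta>_def)
  then have "(\<lambda>n. sqrt ((c\<^sup>2) ^ Suc n * \<beta> (Suc n))) \<longlonglongrightarrow> 0"
    using tendsto_real_sqrt[OF summable_LIMSEQ_zero] by fastforce
  moreover have "sqrt ((c\<^sup>2) ^ n * \<beta> n) = c ^ n * norm ((A ^^ n) x)" for n
    using c by (simp add: \<beta>_def real_sqrt_mult real_sqrt_power)
  ultimately have "(\<lambda>n. c ^ Suc n * norm ((A ^^ Suc n) x)) \<longlonglongrightarrow> 0" by (simp only:)
  then show ?thesis by (rule LIMSEQ_imp_Suc)
qed

section \<open>The dilation inequality\<close>

definition dilation_inequality :: "real \<Rightarrow> ('a::chilbert_space \<Rightarrow> 'a) \<Rightarrow> bool" where
  "dilation_inequality \<rho> A \<longleftrightarrow> (\<forall>g m. (\<Sum>j<m. (norm (A (g j)))\<^sup>2)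
    \<le> \<rho>\<^sup>2 * ((norm (g 0))\<^sup>2 + (\<Sum>j<m. (norm (g (Suc j) - (1 - 1 / \<rho>) *\<^sub>R A (g j)))\<^sup>2)))"

lemma sum_lessThan_add:
  fixes f :: "nat \<Rightarrow> 'b::comm_monoid_add"
  shows "(\<Sum>j<m + k. f j) = (\<Sum>j<m. f j) + (\<Sum>i<k. f (m + i))"
  by (induction k) (simp_all add: add.assoc)

text \<open>The Fourier estimate needs a sequence that ends with \<open>0\<close>. Continuing \<open>g\<close> by
  $g_{m+i} = (cA)^ig_m$ up to $i = n$ adds nonnegative terms on the left, and on the right only the cut-off
  term $\|(cA)^{n+1}g_m\|^2$, which vanishes in the limit.\<close>

lemma resolvent_estimate_imp_dilation_inequality:
  fixes A :: "'a::chilbert_space \<Rightarrow> 'a"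
  assumes A: "bounded_clinear A" and \<rho>: "\<rho> \<ge> 1"
    and est: "\<And>z x. cmod z \<le> 1 \<Longrightarrow> norm (A x) \<le> \<rho> * norm (x - (1 - 1 / \<rho>) *\<^sub>R z *\<^sub>C A x)"
  shows "dilation_inequality \<rho> A"
  unfolding dilation_inequality_def
proof (intro allI)
  fix g :: "nat \<Rightarrow> 'a" and m
  define c where "c = 1 - 1 / \<rho>"
  have c: "0 \<le> c" using \<rho> by (simp add: c_def)
  interpret A: linear A using A by (rule bounded_clinear_linear)
  define h where "h j = g (Suc j) - c *\<^sub>R A (g j)" for j
  define w where "w n = c ^ n *\<^sub>R (A ^^ n) (g m)" for n
  have wSuc: "w (Suc n) = c *\<^sub>R A (w n)" for n by (simp add: w_def A.scaleR)
  have bound: "(\<Sum>j<m. (norm (A (g j)))\<^sup>2)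
      \<le> \<rho>\<^sup>2 * ((norm (g 0))\<^sup>2 + (\<Sum>j<m. (norm (h j))\<^sup>2) + (norm (w (Suc n)))\<^sup>2)" for n
  proof -
    define G where "G j = (if j \<le> m then g j else if j \<le> m + n then w (j - m) else 0)" for j
    have Gm: "G (m + i) = w i" if "i \<le> n" for i
      using that by (cases i) (auto simp: G_def w_def)
    have "(\<Sum>j<m. (norm (A (g j)))\<^sup>2) = (\<Sum>j<m. (norm (A (G j)))\<^sup>2)" by (simp add: G_def)
    also have "\<dots> \<le> (\<Sum>j<m + Suc n. (norm (A (G j)))\<^sup>2)" by (intro sum_mono2) auto
    also have "\<dots> \<le> \<rho>\<^sup>2 * ((norm (G 0))\<^sup>2 + (\<Sum>j<m + Suc n. (norm (G (Suc j) - c *\<^sub>R A (G j)))\<^sup>2))"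
    proof (rule symbol_estimate_imp_finite_sequence_estimate[OF A bounded_clinear_scaleR[OF A]])
      fix \<zeta> x assume "cmod \<zeta> = 1"
      then show "norm (A x) \<le> \<rho> * norm (x - \<zeta> *\<^sub>C c *\<^sub>R A x)"
        using est[of \<zeta> x] by (simp add: c_def scaleR_scaleC_swap)
    qed (simp add: G_def)
    also have "(\<Sum>j<m + Suc n. (norm (G (Suc j) - c *\<^sub>R A (G j)))\<^sup>2)
        = (\<Sum>j<m. (norm (G (Suc j) - c *\<^sub>R A (G j)))\<^sup>2)
          + (\<Sum>i<Suc n. (norm (G (m + Suc i) - c *\<^sub>R A (G (m + i))))\<^sup>2)"
      unfolding sum_lessThan_add by (simp only: add_Suc_right)
    also have "(\<Sum>j<m. (norm (G (Suc j) - c *\<^sub>R A (G j)))\<^sup>2) = (\<Sum>j<m. (norm (h j))\<^sup>2)"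
      by (intro sum.cong) (auto simp: G_def h_def)
    also have "(\<Sum>i<Suc n. (norm (G (m + Suc i) - c *\<^sub>R A (G (m + i))))\<^sup>2) = (norm (w (Suc n)))\<^sup>2"
    proof -
      have "G (m + Suc n) = 0" by (simp add: G_def)
      moreover have "(\<Sum>i<n. (norm (G (m + Suc i) - c *\<^sub>R A (G (m + i))))\<^sup>2) = 0"
        by (intro sum.neutral) (auto simp: Gm wSuc simp del: add_Suc_right)
      ultimately show ?thesis
        by (simp only: sum.lessThan_Suc Gm[OF order.refl]) (simp add: wSuc)
    qed
    finally show ?thesis by (simp add: G_def add.assoc)
  qed
  have "(\<lambda>n. c ^ n * norm ((A ^^ n) (g m))) \<longlonglongrightarrow> 0"
    by (rule resolvent_estimate_imp_powers_decay[OF A c]) (use est in \<open>simp add: c_def\<close>)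
  then have "(\<lambda>n. norm (w (Suc n))) \<longlonglongrightarrow> 0"
    using c by (intro LIMSEQ_Suc) (simp add: w_def)
  then have "(\<lambda>n. \<rho>\<^sup>2 * ((norm (g 0))\<^sup>2 + (\<Sum>j<m. (norm (h j))\<^sup>2) + (norm (w (Suc n)))\<^sup>2))
      \<longlonglongrightarrow> \<rho>\<^sup>2 * ((norm (g 0))\<^sup>2 + (\<Sum>j<m. (norm (h j))\<^sup>2) + 0\<^sup>2)"
    by (intro tendsto_intros)
  then show "(\<Sum>j<m. (norm (A (g j)))\<^sup>2)
    \<le> \<rho>\<^sup>2 * ((norm (g 0))\<^sup>2 + (\<Sum>j<m. (norm (g (Suc j) - (1 - 1 / \<rho>) *\<^sub>R A (g j)))\<^sup>2))"
    using LIMSEQ_le_const[of _ _ "\<Sum>j<m. (norm (A (g j)))\<^sup>2"] bound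
    by (fastforce simp: h_def c_def)
qed

text \<open>Let $d = x - czAx$ and $r = |z|^2 < 1$. For the sequence $z^Nx, \dots, zx, x, cAx$ the differences
  are $z^{N-1}d, \dots, zd, d, 0$, hence
  $\|Ax\|^2\sum_{i\le N} r^i \le \rho^2\,(r^N\|x\|^2 + \|d\|^2\sum_{i<N} r^i)$. As $N \to \infty$ both
  geometric sums tend to $1/(1-r)$. The last element $cAx$ of the sequence is the choice that makes the
  final difference vanish.\<close>

lemma dilation_inequality_imp_resolvent_estimate:
  fixes A :: "'a::chilbert_space \<Rightarrow> 'a"
  assumes A: "bounded_clinear A" and \<rho>: "\<rho> \<ge> 1" and dil: "dilation_inequality \<rho> A"
    and z: "cmod z \<le> 1"
  shows "norm (A x) \<le> \<rho> * norm (x - (1 - 1 / \<rho>) *\<^sub>R z *\<^sub>C A x)"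
proof -
  define c where "c = 1 - 1 / \<rho>"
  interpret A: linear A using A by (rule bounded_clinear_linear)
  have interior: "(norm (A x))\<^sup>2 \<le> \<rho>\<^sup>2 * (norm (x - c *\<^sub>R z *\<^sub>C A x))\<^sup>2" if z: "cmod z < 1" for z
  proof -
    define r where "r = (cmod z)\<^sup>2"
    have r: "0 \<le> r" "r < 1" using z by (auto simp: r_def power_less_one_iff abs_square_less_1)
    define d where "d = x - c *\<^sub>R z *\<^sub>C A x"
    have le: "(\<Sum>i<Suc N. r ^ i) * (norm (A x))\<^sup>2
        \<le> \<rho>\<^sup>2 * (r ^ N * (norm x)\<^sup>2 + (\<Sum>i<N. r ^ i) * (norm d)\<^sup>2)" for N
    proof -
      define g where "g j = (if j \<le> N then z ^ (N - j) *\<^sub>C x else c *\<^sub>R A x)" for j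
      have sq: "(norm (z ^ i *\<^sub>C y))\<^sup>2 = r ^ i * (norm y)\<^sup>2" for i and y :: 'a
        by (simp add: norm_scaleC power_mult_distrib r_def norm_power mult.commute flip: power_mult)
      have "(\<Sum>j<Suc N. (norm (A (g j)))\<^sup>2) = (\<Sum>j<Suc N. r ^ (Suc N - Suc j) * (norm (A x))\<^sup>2)"
        by (intro sum.cong refl) (simp add: g_def bounded_clinear_scaleC[OF A] sq)
      also have "\<dots> = (\<Sum>j<Suc N. r ^ j) * (norm (A x))\<^sup>2"
        unfolding sum_distrib_right by (rule sum.nat_diff_reindex)
      finally have 1: "(\<Sum>j<Suc N. (norm (A (g j)))\<^sup>2) = (\<Sum>j<Suc N. r ^ j) * (norm (A x))\<^sup>2" .
      have "g (Suc j) - c *\<^sub>R A (g j) = z ^ (N - Suc j) *\<^sub>C d" if "j < N" for j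
      proof -
        have "N - j = Suc (N - Suc j)" using that by simp
        then show ?thesis
          using that by (simp add: g_def d_def bounded_clinear_scaleC[OF A] scaleC_diff_right
              scaleC_scaleC scaleR_scaleC_swap mult.commute)
      qed
      then have "(\<Sum>j<N. (norm (g (Suc j) - c *\<^sub>R A (g j)))\<^sup>2) = (\<Sum>j<N. r ^ (N - Suc j) * (norm d)\<^sup>2)"
        by (intro sum.cong refl) (simp add: sq)
      also have "\<dots> = (\<Sum>j<N. r ^ j) * (norm d)\<^sup>2"
        unfolding sum_distrib_right by (rule sum.nat_diff_reindex)
      finally have "(\<Sum>j<Suc N. (norm (g (Suc j) - c *\<^sub>R A (g j)))\<^sup>2) = (\<Sum>j<N. r ^ j) * (norm d)\<^sup>2"
        by (simp add: g_def scaleC_one)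
      moreover have "(norm (g 0))\<^sup>2 = r ^ N * (norm x)\<^sup>2" by (simp add: g_def sq)
      ultimately show ?thesis
        using dil[unfolded dilation_inequality_def, rule_format, of g "Suc N"] 1 by (simp add: c_def)
    qed
    have geo: "(\<lambda>N. \<Sum>i<N. r ^ i) \<longlonglongrightarrow> 1 / (1 - r)"
      using geometric_sums[of r] r by (simp add: sums_def)
    have "1 / (1 - r) * (norm (A x))\<^sup>2 \<le> \<rho>\<^sup>2 * (0 * (norm x)\<^sup>2 + 1 / (1 - r) * (norm d)\<^sup>2)"
    proof (rule LIMSEQ_le)
      show "(\<lambda>N. (\<Sum>i<Suc N. r ^ i) * (norm (A x))\<^sup>2) \<longlonglongrightarrow> 1 / (1 - r) * (norm (A x))\<^sup>2"
        by (intro tendsto_intros LIMSEQ_Suc[OF geo])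
      show "(\<lambda>N. \<rho>\<^sup>2 * (r ^ N * (norm x)\<^sup>2 + (\<Sum>i<N. r ^ i) * (norm d)\<^sup>2))
        \<longlonglongrightarrow> \<rho>\<^sup>2 * (0 * (norm x)\<^sup>2 + 1 / (1 - r) * (norm d)\<^sup>2)"
        using r by (intro tendsto_intros geo LIMSEQ_power_zero) auto
    qed (use le in blast)
    then show ?thesis using r by (simp add: divide_simps d_def)
  qed
  \<comment> \<open>points of the unit circle are reached along their radius\<close>
  define y where "y n = x - (1 - 1 / real (Suc n)) *\<^sub>R c *\<^sub>R z *\<^sub>C A x" for n
  have "(\<lambda>n. 1 / real (Suc n)) \<longlonglongrightarrow> 0" by (rule LIMSEQ_Suc[OF lim_1_over_n])
  then have "y \<longlonglongrightarrow> x - (1 - 0) *\<^sub>R c *\<^sub>R z *\<^sub>C A x"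
    unfolding y_def by (intro tendsto_intros)
  then have "(\<lambda>n. \<rho>\<^sup>2 * (norm (y n))\<^sup>2) \<longlonglongrightarrow> \<rho>\<^sup>2 * (norm (x - c *\<^sub>R z *\<^sub>C A x))\<^sup>2"
    by (intro tendsto_intros) simp
  moreover have "(norm (A x))\<^sup>2 \<le> \<rho>\<^sup>2 * (norm (y n))\<^sup>2" for n
  proof -
    have "cmod (of_real (1 - 1 / real (Suc n)) * z) < 1"
    proof -
      have "\<bar>1 - 1 / real (Suc n)\<bar> * cmod z \<le> \<bar>1 - 1 / real (Suc n)\<bar> * 1"
        using z by (intro mult_left_mono) auto
      also have "\<dots> < 1" by simp
      finally show ?thesis by (simp add: norm_mult del: of_nat_Suc of_real_diff)
    qed
    from interior[OF this] show ?thesis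
      by (simp add: y_def scaleR_scaleC scaleC_scaleC mult_ac del: of_real_diff of_nat_Suc)
  qed
  ultimately have "(norm (A x))\<^sup>2 \<le> \<rho>\<^sup>2 * (norm (x - c *\<^sub>R z *\<^sub>C A x))\<^sup>2"
    using LIMSEQ_le_const by blast
  then have "(norm (A x))\<^sup>2 \<le> (\<rho> * norm (x - c *\<^sub>R z *\<^sub>C A x))\<^sup>2"
    by (simp add: power_mult_distrib)
  then show ?thesis using \<rho> by (simp add: c_def power2_le_iff_abs_le)
qed

section \<open>From a dilation to the dilation inequality\<close>

lemma energy_eq:
  fixes a b :: "'a::real_inner"
  assumes "\<rho> \<noteq> 0"
  shows "(norm (b - a))\<^sup>2 + 2 / \<rho> * inner a (b - a)
    = (norm (b - (1 - 1 / \<rho>) *\<^sub>R a))\<^sup>2 - (norm a)\<^sup>2 / \<rho>\<^sup>2"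
proof -
  have "(1 - 1 / \<rho>)\<^sup>2 = 1 - 2 / \<rho> + 1 / \<rho>\<^sup>2"
    using assms by (simp add: power2_diff power_divide)
  moreover have "inner a (b - a) = inner b a - (norm a)\<^sup>2"
    by (simp add: inner_diff_right inner_commute power2_norm_eq_inner)
  moreover have "(norm (b - (1 - 1 / \<rho>) *\<^sub>R a))\<^sup>2
      = (norm b)\<^sup>2 - 2 * (1 - 1 / \<rho>) * inner b a + (1 - 1 / \<rho>)\<^sup>2 * (norm a)\<^sup>2"
    by (simp add: norm_diff_square power_mult_distrib)
  ultimately show ?thesis
    by (simp add: norm_diff_square[of b a])
      (simp add: algebra_simps diff_divide_distrib add_divide_distrib)
qed

text \<open>In terms of $v_0 = g_0$ and $v_{j+1} = g_{j+1} - Ag_j$ the right-hand side is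
  $\sum_j \|v_j\|^2 + \frac{2}{\rho}\sum_j \mathrm{Re}\,\langle Ag_j, v_{j+1}\rangle$, which is how both a dilation
  and the Toeplitz form produce it.\<close>

lemma dilation_inequality_iff_energy_nonneg:
  assumes \<rho>: "\<rho> \<ge> 1"
  shows "dilation_inequality \<rho> A \<longleftrightarrow> (\<forall>g m. 0 \<le> (norm (g 0))\<^sup>2
    + (\<Sum>j<m. (norm (g (Suc j) - A (g j)))\<^sup>2 + 2 / \<rho> * inner (A (g j)) (g (Suc j) - A (g j))))"
proof -
  have "\<rho> \<noteq> 0" "\<rho>\<^sup>2 > 0" using \<rho> by auto
  have "(\<Sum>j<m. (norm (A (g j)))\<^sup>2)
      \<le> \<rho>\<^sup>2 * ((norm (g 0))\<^sup>2 + (\<Sum>j<m. (norm (g (Suc j) - (1 - 1 / \<rho>) *\<^sub>R A (g j)))\<^sup>2))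
    \<longleftrightarrow> 0 \<le> (norm (g 0))\<^sup>2
    + (\<Sum>j<m. (norm (g (Suc j) - A (g j)))\<^sup>2 + 2 / \<rho> * inner (A (g j)) (g (Suc j) - A (g j)))" for g m
    unfolding energy_eq[OF \<open>\<rho> \<noteq> 0\<close>] sum_subtractf sum_divide_distrib[symmetric] add_diff_eq
      diff_ge_0_iff_ge pos_divide_le_eq[OF \<open>\<rho>\<^sup>2 > 0\<close>] by (simp add: mult.commute)
  then show ?thesis unfolding dilation_inequality_def by simp
qed

lemma linear_funpow:
  fixes A :: "'a::real_vector \<Rightarrow> 'a"
  assumes "linear A"
  shows "linear (A ^^ n)"
proof (induction n)
  case (Suc n)
  then show ?case using linear_compose[OF Suc assms] by (simp add: o_def)
qed (simp add: linear_id[unfolded id_def] id_def)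

text \<open>For $v_0 = g_0$, $v_{j+1} = g_{j+1} - Ag_j$ and $e_m = \sum_{j\le m} U^{m-j}Jv_j$, the energy of
  \<open>g\<close> is $\|e_m\|^2$: passing from $e_m$ to $e_{m+1} = Ue_m + Jv_{m+1}$ adds
  $2\,\mathrm{Re}\,\langle Ue_m, Jv_{m+1}\rangle + \|v_{m+1}\|^2$, and since $U^nJ$ compresses to
  $A^n/\rho$ for $n \ge 1$, the vector $Ue_m$ compresses to $Ag_m/\rho$.\<close>

lemma rho_contraction_imp_dilation_inequality:
  fixes A :: "'a::chilbert_space \<Rightarrow> 'a"
  assumes A: "bounded_clinear A" and \<rho>: "\<rho> \<ge> 1" and contr: "rho_contraction \<rho> A"
  shows "dilation_inequality \<rho> A"
proof -
  obtain S :: "(int \<Rightarrow> 'a) set" and ip J U P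
    where H: "hilbert_space_on S ip" and emb: "isometric_embedding S ip J"
      and uni: "unitary_on S ip U" and P: "orthogonal_projection_on S ip (range J) P"
      and pow: "\<And>n x. n \<ge> 1 \<Longrightarrow> J ((A ^^ n) x) = complex_of_real \<rho> *\<^sub>C P ((U ^^ n) (J x))"
    using contr unfolding rho_contraction_def unitary_rho_dilation_def by blast
  interpret hilbert_space_on S ip by (fact H)
  have JS: "J x \<in> S" and Jip: "ip (J x) (J y) = cinner x y" for x y
    using emb by (auto simp: isometric_embedding_def)
  have U: "unitary_on S ip (U ^^ n)" for n by (rule unitary_on_funpow[OF uni])
  have US: "(U ^^ n) x \<in> S" if "x \<in> S" for n x
    using U[of n] that by (auto simp: unitary_on_def bij_betw_def)
  have US1: "U x \<in> S" if "x \<in> S" for x using US[of x 1] that by simp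
  have compress: "ip ((U ^^ Suc n) (J x)) (J b) = 1 / \<rho> * cinner ((A ^^ Suc n) x) b" for n x b
  proof -
    define k where "k = (U ^^ Suc n) (J x)"
    have k: "k \<in> S" unfolding k_def by (rule US[OF JS])
    then have Pk: "P k \<in> S" "ip (k - P k) (J b) = 0"
      using P JS by (auto simp: orthogonal_projection_on_def)
    have "cinner ((A ^^ Suc n) x) b = of_real \<rho> * ip (P k) (J b)"
      using pow[of "Suc n" x] Pk JS by (simp add: ip_scaleC_left k_def flip: Jip)
    also have "ip (P k) (J b) = ip k (J b)" using Pk k JS by (simp add: ip_diff_left)
    finally show ?thesis using \<rho> by (simp add: k_def)
  qed
  show ?thesis
    unfolding dilation_inequality_iff_energy_nonneg[OF \<rho>]
  proof (intro allI)
    fix g :: "nat \<Rightarrow> 'a" and m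
    define v where "v l = g (Suc l) - A (g l)" for l
    define e where "e = rec_nat (J (g 0)) (\<lambda>l k. U k + J (v l))"
    have e: "e 0 = J (g 0)" "e (Suc l) = U (e l) + J (v l)" for l by (simp_all add: e_def)
    have eS: "e l \<in> S" for l
    proof (induction l)
      case 0
      show ?case unfolding e(1) by (rule JS)
    next
      case (Suc l)
      show ?case unfolding e(2) by (rule add_mem[OF US1[OF Suc] JS])
    qed
    have corr: "ip ((U ^^ Suc n) (e l)) (J b) = 1 / \<rho> * cinner ((A ^^ Suc n) (g l)) b" for n l b
    proof (induction l arbitrary: n)
      case 0
      show ?case unfolding e(1) by (rule compress)
    next
      case (Suc l)
      have "(U ^^ Suc n) (U (e l) + J (v l)) = (U ^^ Suc n) (U (e l)) + (U ^^ Suc n) (J (v l))"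
        using U[of "Suc n"] US1[OF eS] JS unfolding unitary_on_def by blast
      then have "(U ^^ Suc n) (e (Suc l)) = (U ^^ Suc (Suc n)) (e l) + (U ^^ Suc n) (J (v l))"
        by (simp only: e funpow_Suc_right o_apply)
      then have "ip ((U ^^ Suc n) (e (Suc l))) (J b)
          = 1 / \<rho> * (cinner ((A ^^ Suc (Suc n)) (g l)) b + cinner ((A ^^ Suc n) (v l)) b)"
        using ip_add_left[OF US[OF eS, of "Suc (Suc n)" l] US[OF JS, of "Suc n" "v l"] JS[of b]]
        by (simp only: Suc.IH compress distrib_left)
      also have "\<dots> = 1 / \<rho> * cinner ((A ^^ Suc n) (A (g l) + v l)) b"
        using linear_add[OF linear_funpow[OF bounded_clinear_linear[OF A], of "Suc n"]]
        by (simp only: cinner_add_left funpow_Suc_right[of "Suc n"] o_apply)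
      finally show ?case by (simp add: v_def)
    qed
    have "Re (ip (e m) (e m))
        = (norm (g 0))\<^sup>2 + (\<Sum>j<m. (norm (v j))\<^sup>2 + 2 / \<rho> * inner (A (g j)) (v j))"
    proof (induction m)
      case 0
      show ?case by (simp add: e Jip cinner_self del: of_real_power)
    next
      case (Suc m)
      have c: "ip (U (e m)) (J (v m)) = 1 / \<rho> * cinner (A (g m)) (v m)"
        using corr[of 0 m "v m"] by simp
      have "ip (U (e m)) (U (e m)) = ip (e m) (e m)" using uni eS by (simp add: unitary_on_def)
      moreover have "ip (J (v m)) (U (e m)) = cnj (ip (U (e m)) (J (v m)))"
        by (rule ip_commute[OF JS US1[OF eS]])
      ultimately have "ip (e (Suc m)) (e (Suc m)) = ip (e m) (e m)
          + (ip (U (e m)) (J (v m)) + cnj (ip (U (e m)) (J (v m)))) + of_real ((norm (v m))\<^sup>2)"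
        using eS JS US1
        by (simp add: e ip_add_left ip_add_right add_mem Jip cinner_self algebra_simps)
      then have "Re (ip (e (Suc m)) (e (Suc m)))
          = Re (ip (e m) (e m)) + 2 * Re (ip (U (e m)) (J (v m))) + (norm (v m))\<^sup>2"
        by (simp del: of_real_power)
      also have "Re (ip (U (e m)) (J (v m))) = 1 / \<rho> * inner (A (g m)) (v m)"
        unfolding c by (simp add: inner_eq_Re_cinner)
      finally show ?case using Suc.IH by simp
    qed
    then show "0 \<le> (norm (g 0))\<^sup>2 + (\<Sum>j<m. (norm (g (Suc j) - A (g j)))\<^sup>2
        + 2 / \<rho> * inner (A (g j)) (g (Suc j) - A (g j)))"
      using ip_self_nonneg[OF eS, of m] by (simp add: v_def)
  qed
qed


section \<open>The Toeplitz kernel\<close>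

text \<open>The value that $\langle U^iJx, U^jJy\rangle$ takes for a $\rho$-dilation \<open>U\<close> when \<open>n = i - j\<close>. Moving
  negative powers to the second argument avoids the adjoint.\<close>

definition toeplitz_kernel :: "real \<Rightarrow> ('a::chilbert_space \<Rightarrow> 'a) \<Rightarrow> int \<Rightarrow> 'a \<Rightarrow> 'a \<Rightarrow> complex" where
  "toeplitz_kernel \<rho> A n x y =
    (if n = 0 then cinner x y
     else if n > 0 then cinner ((A ^^ nat n) x) y / \<rho>
     else cinner x ((A ^^ nat (- n)) y) / \<rho>)"

lemma toeplitz_kernel_commute: "toeplitz_kernel \<rho> A n x y = cnj (toeplitz_kernel \<rho> A (- n) y x)"
  using cinner_commute[of x y] cinner_commute[of "(A ^^ nat n) x" y]
    cinner_commute[of x "(A ^^ nat (- n)) y"]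
  by (auto simp: toeplitz_kernel_def)

lemma toeplitz_kernel_add_left:
  assumes "bounded_clinear A"
  shows "toeplitz_kernel \<rho> A n (x + x') y = toeplitz_kernel \<rho> A n x y + toeplitz_kernel \<rho> A n x' y"
  using linear_add[OF linear_funpow[OF bounded_clinear_linear[OF assms]]]
  by (simp add: toeplitz_kernel_def cinner_add_left add_divide_distrib)

lemma toeplitz_kernel_scaleC_left:
  assumes "bounded_clinear A"
  shows "toeplitz_kernel \<rho> A n (c *\<^sub>C x) y = c * toeplitz_kernel \<rho> A n x y"
proof -
  have "(A ^^ k) (c *\<^sub>C x) = c *\<^sub>C (A ^^ k) x" for k
    by (induction k) (simp_all add: bounded_clinear_scaleC[OF assms])
  then show ?thesis by (simp add: toeplitz_kernel_def cinner_scaleC_left)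
qed

primrec orbit_sum :: "('a::plus \<Rightarrow> 'a) \<Rightarrow> (nat \<Rightarrow> 'a) \<Rightarrow> nat \<Rightarrow> 'a" where
  "orbit_sum A v 0 = v 0"
| "orbit_sum A v (Suc n) = A (orbit_sum A v n) + v (Suc n)"

lemma orbit_sum_eq:
  assumes "linear A"
  shows "orbit_sum A v n = (\<Sum>k<Suc n. (A ^^ (n - k)) (v k))"
proof (induction n)
  case (Suc n)
  have "A (orbit_sum A v n) = (\<Sum>k<Suc n. (A ^^ (Suc n - k)) (v k))"
    unfolding Suc linear_sum[OF assms]
    by (intro sum.cong refl) (simp add: Suc_diff_le)
  then show ?case by simp
qed simp

text \<open>The entries with $k \le m$ and $l = m + 1$ sum to $\langle Ag_m, v_{m+1}\rangle/\rho$, where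
  $g_m = \sum_{k\le m} A^{m-k}v_k$, and those with $k = m + 1$ and $l \le m$ to its conjugate. So enlarging
  the index set by one adds exactly one energy term.\<close>

lemma toeplitz_form_eq_energy:
  fixes A :: "'a::chilbert_space \<Rightarrow> 'a"
  assumes A: "bounded_clinear A"
  shows "Re (\<Sum>k<Suc m. \<Sum>l<Suc m. toeplitz_kernel \<rho> A (int l - int k) (v k) (v l))
    = (norm (v 0))\<^sup>2 + (\<Sum>j<m. (norm (v (Suc j)))\<^sup>2 + 2 / \<rho> * inner (A (orbit_sum A v j)) (v (Suc j)))"
proof (induction m)
  case 0
  show ?case by (simp add: toeplitz_kernel_def cinner_self del: of_real_power)
next
  case (Suc m)
  define f where "f k l = toeplitz_kernel \<rho> A (int l - int k) (v k) (v l)" for k l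
  define n where "n = Suc m"
  have lin: "linear A" using A by (rule bounded_clinear_linear)
  have "(\<Sum>k<n. f k n) = (\<Sum>k<n. cinner (A ((A ^^ (m - k)) (v k))) (v n) / \<rho>)"
  proof (intro sum.cong refl)
    fix k assume "k \<in> {..<n}"
    then have "nat (int n - int k) = Suc (m - k)" "int n - int k > 0" by (auto simp: n_def)
    then show "f k n = cinner (A ((A ^^ (m - k)) (v k))) (v n) / \<rho>"
      by (simp add: f_def toeplitz_kernel_def)
  qed
  also have "\<dots> = cinner (A (orbit_sum A v m)) (v n) / \<rho>"
    unfolding orbit_sum_eq[OF lin] linear_sum[OF lin] cinner_sum_left sum_divide_distrib n_def
    by (rule refl)
  finally have row: "(\<Sum>k<n. f k n) = cinner (A (orbit_sum A v m)) (v n) / \<rho>" .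
  have "f n l = cnj (f l n)" for l
    using toeplitz_kernel_commute[of \<rho> A "int l - int n" "v n" "v l"] by (simp add: f_def)
  then have column: "(\<Sum>l<n. f n l) = cnj (\<Sum>k<n. f k n)" unfolding cnj_sum by (intro sum.cong refl)
  have diag: "f n n = of_real ((norm (v n))\<^sup>2)" by (simp add: f_def toeplitz_kernel_def cinner_self)
  have "(\<Sum>k<Suc n. \<Sum>l<Suc n. f k l)
      = (\<Sum>k<n. \<Sum>l<n. f k l) + ((\<Sum>k<n. f k n) + cnj (\<Sum>k<n. f k n)) + f n n"
    by (simp add: sum.distrib column del: cnj_sum)
  then have "Re (\<Sum>k<Suc n. \<Sum>l<Suc n. f k l)
      = Re (\<Sum>k<n. \<Sum>l<n. f k l) + 2 * Re (\<Sum>k<n. f k n) + (norm (v n))\<^sup>2"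
    unfolding diag by (simp only: plus_complex.sel complex_cnj Re_complex_of_real) simp
  also have "Re (\<Sum>k<n. f k n) = inner (A (orbit_sum A v m)) (v n) / \<rho>"
    unfolding row by (simp add: inner_eq_Re_cinner)
  also have "Re (\<Sum>k<n. \<Sum>l<n. f k l) = (norm (v 0))\<^sup>2
      + (\<Sum>j<m. (norm (v (Suc j)))\<^sup>2 + 2 / \<rho> * inner (A (orbit_sum A v j)) (v (Suc j)))"
    using Suc by (simp only: f_def n_def)
  finally have "Re (\<Sum>k<Suc n. \<Sum>l<Suc n. f k l) = (norm (v 0))\<^sup>2
      + ((\<Sum>j<m. (norm (v (Suc j)))\<^sup>2 + 2 / \<rho> * inner (A (orbit_sum A v j)) (v (Suc j)))
        + ((norm (v n))\<^sup>2 + 2 / \<rho> * inner (A (orbit_sum A v m)) (v n)))"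
    by (simp del: sum.lessThan_Suc)
  then show ?case by (simp only: sum.lessThan_Suc[of _ m] f_def n_def)
qed

lemma toeplitz_form_nonneg:
  fixes A :: "'a::chilbert_space \<Rightarrow> 'a"
  assumes A: "bounded_clinear A" and \<rho>: "\<rho> \<ge> 1" and dil: "dilation_inequality \<rho> A"
  shows "0 \<le> Re (\<Sum>i\<in>{- int m..int m}. \<Sum>j\<in>{- int m..int m}. toeplitz_kernel \<rho> A (i - j) (u i) (u j))"
proof -
  \<comment> \<open>reversing the order makes the powers of \<open>A\<close> act on the earlier entries\<close>
  define v where "v k = u (int m - int k)" for k
  have bij: "bij_betw (\<lambda>k. int m - int k) {..<Suc (2 * m)} {- int m..int m}"
    by (rule bij_betw_byWitness[where f' = "\<lambda>i. nat (int m - i)"]) auto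
  have "(\<Sum>i\<in>{- int m..int m}. \<Sum>j\<in>{- int m..int m}. toeplitz_kernel \<rho> A (i - j) (u i) (u j))
      = (\<Sum>k<Suc (2 * m). \<Sum>l<Suc (2 * m). toeplitz_kernel \<rho> A (int l - int k) (v k) (v l))"
    unfolding sum.reindex_bij_betw[OF bij, symmetric] v_def by simp
  also have "Re \<dots> = (norm (v 0))\<^sup>2
      + (\<Sum>j<2 * m. (norm (v (Suc j)))\<^sup>2 + 2 / \<rho> * inner (A (orbit_sum A v j)) (v (Suc j)))"
    by (rule toeplitz_form_eq_energy[OF A])
  also have "0 \<le> \<dots>"
    using dil[unfolded dilation_inequality_iff_energy_nonneg[OF \<rho>], rule_format, of "orbit_sum A v" "2 * m"]
    by simp
  finally show ?thesis by simp
qed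

section \<open>Completing a semi-inner product space\<close>

locale semi_inner_space =
  fixes V :: "'v::complex_vector set" and K :: "'v \<Rightarrow> 'v \<Rightarrow> complex"
  assumes zero_V: "0 \<in> V"
    and add_V: "\<lbrakk>x \<in> V; y \<in> V\<rbrakk> \<Longrightarrow> x + y \<in> V"
    and scaleC_V: "x \<in> V \<Longrightarrow> c *\<^sub>C x \<in> V"
    and K_commute: "\<lbrakk>x \<in> V; y \<in> V\<rbrakk> \<Longrightarrow> K x y = cnj (K y x)"
    and K_add_left: "\<lbrakk>x \<in> V; y \<in> V; z \<in> V\<rbrakk> \<Longrightarrow> K (x + y) z = K x z + K y z"
    and K_scaleC_left: "\<lbrakk>x \<in> V; y \<in> V\<rbrakk> \<Longrightarrow> K (c *\<^sub>C x) y = c * K x y"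
    and K_nonneg: "x \<in> V \<Longrightarrow> 0 \<le> Re (K x x)"
begin

lemma diff_V: "x \<in> V \<Longrightarrow> y \<in> V \<Longrightarrow> x - y \<in> V"
  using add_V[of x "- y"] scaleC_V[of y "-1"] by (simp add: scaleC_minus_one)

lemma K_diff_left: "x \<in> V \<Longrightarrow> y \<in> V \<Longrightarrow> z \<in> V \<Longrightarrow> K (x - y) z = K x z - K y z"
  using K_add_left[of "x - y" y z] diff_V[of x y] by simp

lemma K_zero_left: "z \<in> V \<Longrightarrow> K 0 z = 0"
  using K_diff_left[of 0 0 z] zero_V by simp

lemma K_add_right: "x \<in> V \<Longrightarrow> y \<in> V \<Longrightarrow> z \<in> V \<Longrightarrow> K z (x + y) = K z x + K z y"
  using K_commute[of z "x + y"] K_commute[of z x] K_commute[of z y] K_add_left[of x y z] add_V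
  by simp

lemma K_diff_right: "x \<in> V \<Longrightarrow> y \<in> V \<Longrightarrow> z \<in> V \<Longrightarrow> K z (x - y) = K z x - K z y"
  using K_commute[of z "x - y"] K_commute[of z x] K_commute[of z y] K_diff_left[of x y z] diff_V
  by simp

lemma K_scaleC_right: "x \<in> V \<Longrightarrow> z \<in> V \<Longrightarrow> K z (c *\<^sub>C x) = cnj c * K z x"
  using K_commute[of z "c *\<^sub>C x"] K_commute[of z x] K_scaleC_left[of x z c] scaleC_V by simp

definition seminorm :: "'v \<Rightarrow> real" where
  "seminorm x = sqrt (Re (K x x))"

lemma seminorm_nonneg: "x \<in> V \<Longrightarrow> 0 \<le> seminorm x"
  by (simp add: seminorm_def K_nonneg)

lemma seminorm_square: "x \<in> V \<Longrightarrow> (seminorm x)\<^sup>2 = Re (K x x)"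
  by (simp add: seminorm_def K_nonneg)

lemma K_Cauchy_Schwarz:
  assumes "x \<in> V" "y \<in> V"
  shows "cmod (K x y) \<le> seminorm x * seminorm y"
proof -
  define q a b where "q = (cmod (K x y))\<^sup>2" and "a = Re (K x x)" and "b = Re (K y y)"
  have a: "0 \<le> a" and b: "0 \<le> b" using assms K_nonneg by (auto simp: a_def b_def)
  have quadratic: "0 \<le> a - 2 * s * q + s\<^sup>2 * q * b" for s :: real
  proof -
    define t where "t = complex_of_real s * K x y"
    have qq: "K x y * cnj (K x y) = complex_of_real q"
      unfolding q_def by (rule complex_norm_square[symmetric])
    have ty: "t *\<^sub>C y \<in> V" using assms scaleC_V by simp
    have "K (x - t *\<^sub>C y) (x - t *\<^sub>C y)
        = K x x - cnj t * K x y - t * K y x + t * cnj t * K y y"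
      using assms ty diff_V[OF assms(1) ty]
      by (simp add: K_diff_left K_diff_right K_scaleC_left K_scaleC_right algebra_simps)
    also have "\<dots> = K x x - of_real (2 * s) * (K x y * cnj (K x y))
        + of_real (s\<^sup>2) * (K x y * cnj (K x y)) * K y y"
      unfolding K_commute[OF assms(2,1)] t_def by (simp add: algebra_simps power2_eq_square)
    finally have "Re (K (x - t *\<^sub>C y) (x - t *\<^sub>C y)) = a - 2 * s * q + s\<^sup>2 * q * b"
      unfolding qq a_def b_def by (simp flip: of_real_mult of_real_power)
    then show ?thesis using K_nonneg[OF diff_V[OF assms(1) ty]] by simp
  qed
  have "q \<le> a * b"
  proof (cases "b = 0")
    case True
    show ?thesis
    proof (rule ccontr)
      assume "\<not> q \<le> a * b"
      then have "q > 0" using True by simp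
      then show False using quadratic[of "(a + 1) / q"] True a by simp
    qed
  next
    case False
    then show ?thesis using quadratic[of "1 / b"] b by (simp add: field_simps power2_eq_square)
  qed
  then have "sqrt q \<le> sqrt (a * b)" by (rule real_sqrt_le_mono)
  then show ?thesis by (simp add: q_def a_def b_def seminorm_def real_sqrt_mult)
qed

definition bounded_by :: "('v \<Rightarrow> complex) \<Rightarrow> real \<Rightarrow> bool" where
  "bounded_by F e \<longleftrightarrow> (\<forall>v\<in>V. cmod (F v) \<le> e * seminorm v)"

definition embed :: "'v \<Rightarrow> 'v \<Rightarrow> complex" where
  "embed u = (\<lambda>v. if v \<in> V then K u v else 0)"

text \<open>The elements of the completion are antilinear functionals on \<open>V\<close>, an element $u$ of \<open>V\<close> standing for
  $v \mapsto K(u, v)$. This identifies vectors at distance zero without a quotient, and the result is a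
  subset of a vector space of functions, as \<open>hilbert_space_on\<close> requires. The completion consists of the
  functionals that are limits, in the dual norm, of those given by elements of \<open>V\<close>; functionals are set
  to \<open>0\<close> off \<open>V\<close> so that they are determined by their values on \<open>V\<close>.\<close>

definition hilbert_completion :: "('v \<Rightarrow> complex) set" where
  "hilbert_completion = {F. (\<forall>v. v \<notin> V \<longrightarrow> F v = 0) \<and> (\<forall>e>0. \<exists>u\<in>V. bounded_by (\<lambda>v. F v - K u v) e)}"

definition approximates :: "(nat \<Rightarrow> 'v) \<Rightarrow> ('v \<Rightarrow> complex) \<Rightarrow> bool" where
  "approximates u F \<longleftrightarrow> (\<exists>e. (\<forall>n. u n \<in> V \<and> 0 \<le> e n \<and> bounded_by (\<lambda>v. F v - K (u n) v) (e n)) \<and> e \<longlonglongrightarrow> 0)"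

text \<open>If $v_n \to G$, then $\langle F, v_n\rangle = F(v_n)$ should converge to $\langle F, G\rangle$. In this form
  linearity in \<open>F\<close> is immediate; independence of the approximating sequence is
  \<open>completion_ip_limit\<close>.\<close>

definition completion_ip :: "('v \<Rightarrow> complex) \<Rightarrow> ('v \<Rightarrow> complex) \<Rightarrow> complex" where
  "completion_ip F G = lim (\<lambda>n. F ((SOME v. approximates v G) n))"

lemma bounded_byD: "bounded_by F e \<Longrightarrow> v \<in> V \<Longrightarrow> cmod (F v) \<le> e * seminorm v"
  by (simp add: bounded_by_def)

lemma bounded_by_add: "bounded_by F d \<Longrightarrow> bounded_by G e \<Longrightarrow> bounded_by (\<lambda>v. F v + G v) (d + e)"
  by (auto simp: bounded_by_def distrib_right intro: norm_triangle_mono)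

lemma bounded_by_scale: "bounded_by F e \<Longrightarrow> bounded_by (\<lambda>v. c * F v) (cmod c * e)"
  by (auto simp: bounded_by_def norm_mult mult.assoc intro!: mult_left_mono)

lemma bounded_by_diff:
  assumes "bounded_by F d" "bounded_by G e"
  shows "bounded_by (\<lambda>v. F v - G v) (d + e)"
  using bounded_by_add[OF assms(1) bounded_by_scale[OF assms(2), of "-1"]] by simp

lemma bounded_by_mono: "bounded_by F d \<Longrightarrow> d \<le> e \<Longrightarrow> bounded_by F e"
  unfolding bounded_by_def
  by (meson mult_right_mono order.trans seminorm_nonneg)

lemma bounded_by_K: "u \<in> V \<Longrightarrow> bounded_by (K u) (seminorm u)"
  by (simp add: bounded_by_def K_Cauchy_Schwarz)

lemma seminorm_le:
  assumes "u \<in> V" "bounded_by (K u) e" "0 \<le> e"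
  shows "seminorm u \<le> e"
proof (cases "seminorm u = 0")
  case False
  have "(seminorm u)\<^sup>2 \<le> e * seminorm u"
    using bounded_byD[OF assms(2,1)] complex_Re_le_cmod[of "K u u"]
    by (simp add: seminorm_square assms(1))
  then show ?thesis
    using False seminorm_nonneg[OF assms(1)] by (simp add: power2_eq_square)
qed (use assms in simp)

lemma hilbert_completionD: "F \<in> hilbert_completion \<Longrightarrow> v \<notin> V \<Longrightarrow> F v = 0"
  by (simp add: hilbert_completion_def)

lemma completion_approximates:
  assumes "F \<in> hilbert_completion"
  shows "\<exists>u. approximates u F"
proof -
  have "\<forall>n. \<exists>u\<in>V. bounded_by (\<lambda>v. F v - K u v) (1 / real (Suc n))"
    using assms by (simp add: hilbert_completion_def)
  then obtain u where "\<And>n. u n \<in> V \<and> bounded_by (\<lambda>v. F v - K (u n) v) (1 / real (Suc n))"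
    by metis
  moreover have "(\<lambda>n. 1 / real (Suc n)) \<longlonglongrightarrow> 0" by (rule LIMSEQ_Suc[OF lim_1_over_n])
  ultimately show ?thesis
    unfolding approximates_def by (intro exI[of _ u] exI[of _ "\<lambda>n. 1 / real (Suc n)"]) simp
qed

lemma approximates_imp_completion:
  assumes "\<And>v. v \<notin> V \<Longrightarrow> F v = 0" "approximates u F"
  shows "F \<in> hilbert_completion"
proof -
  obtain e where e: "\<And>n. u n \<in> V \<and> 0 \<le> e n \<and> bounded_by (\<lambda>v. F v - K (u n) v) (e n)" "e \<longlonglongrightarrow> 0"
    using assms(2) by (auto simp: approximates_def)
  have "\<exists>u\<in>V. bounded_by (\<lambda>v. F v - K u v) d" if "d > 0" for d
  proof -
    have "\<forall>\<^sub>F n in sequentially. e n < d" using e(2) that by (rule order_tendstoD)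
    then obtain n where "e n < d" by (auto simp: eventually_sequentially)
    then show ?thesis using e(1)[of n] bounded_by_mono less_imp_le by blast
  qed
  then show ?thesis using assms(1) by (simp add: hilbert_completion_def)
qed

lemma approximates_mem: "approximates u F \<Longrightarrow> u n \<in> V"
  by (auto simp: approximates_def)

lemma approximates_add:
  assumes "approximates u F" "approximates v G"
  shows "approximates (\<lambda>n. u n + v n) (\<lambda>x. F x + G x)"
proof -
  obtain d where d: "\<And>n. u n \<in> V \<and> 0 \<le> d n \<and> bounded_by (\<lambda>v. F v - K (u n) v) (d n)" "d \<longlonglongrightarrow> 0"
    using assms(1) by (auto simp: approximates_def)
  obtain e where e: "\<And>n. v n \<in> V \<and> 0 \<le> e n \<and> bounded_by (\<lambda>x. G x - K (v n) x) (e n)" "e \<longlonglongrightarrow> 0"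
    using assms(2) by (auto simp: approximates_def)
  have "bounded_by (\<lambda>x. F x + G x - K (u n + v n) x) (d n + e n)" for n
    using bounded_by_add[of "\<lambda>x. F x - K (u n) x" "d n" "\<lambda>x. G x - K (v n) x" "e n"] d(1)[of n] e(1)[of n]
    by (simp add: bounded_by_def K_add_left algebra_simps)
  moreover have "(\<lambda>n. d n + e n) \<longlonglongrightarrow> 0" using tendsto_add[OF d(2) e(2)] by simp
  ultimately show ?thesis
    using d(1) e(1) unfolding approximates_def by (intro exI[of _ "\<lambda>n. d n + e n"]) (auto intro: add_V)
qed

lemma approximates_scale:
  assumes "approximates u F"
  shows "approximates (\<lambda>n. c *\<^sub>C u n) (\<lambda>x. c * F x)"
proof -
  obtain d where d: "\<And>n. u n \<in> V \<and> 0 \<le> d n \<and> bounded_by (\<lambda>v. F v - K (u n) v) (d n)" "d \<longlonglongrightarrow> 0"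
    using assms(1) by (auto simp: approximates_def)
  have "bounded_by (\<lambda>x. c * F x - K (c *\<^sub>C u n) x) (cmod c * d n)" for n
    using bounded_by_scale[of "\<lambda>x. F x - K (u n) x" "d n" c] d(1)[of n]
    by (simp add: bounded_by_def K_scaleC_left algebra_simps)
  moreover have "(\<lambda>n. cmod c * d n) \<longlonglongrightarrow> 0" using tendsto_mult_left[OF d(2)] by simp
  ultimately show ?thesis
    using d(1) unfolding approximates_def by (intro exI[of _ "\<lambda>n. cmod c * d n"]) (auto intro: scaleC_V)
qed

lemma approximates_embed: "u \<in> V \<Longrightarrow> approximates (\<lambda>n. u) (embed u)"
  unfolding approximates_def
  by (intro exI[of _ "\<lambda>n. 0"]) (simp add: bounded_by_def embed_def)

lemma embed_in_completion: "u \<in> V \<Longrightarrow> embed u \<in> hilbert_completion"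
  by (rule approximates_imp_completion[OF _ approximates_embed]) (simp add: embed_def)

lemma completion_bounded:
  assumes "F \<in> hilbert_completion"
  obtains C where "0 \<le> C" "bounded_by F C"
proof -
  obtain u where u: "u \<in> V" "bounded_by (\<lambda>v. F v - K u v) 1"
    using assms zero_less_one[where 'a = real] unfolding hilbert_completion_def by blast
  then have "bounded_by F (1 + seminorm u)"
    using bounded_by_add[OF u(2) bounded_by_K[OF u(1)]] by simp
  then show thesis using that[of "1 + seminorm u"] seminorm_nonneg[OF u(1)] by simp
qed

lemma approximates_pointwise:
  assumes "approximates u F" "x \<in> V"
  shows "(\<lambda>n. K (u n) x) \<longlonglongrightarrow> F x"
proof -
  obtain e where e: "\<And>n. u n \<in> V \<and> 0 \<le> e n \<and> bounded_by (\<lambda>v. F v - K (u n) v) (e n)" "e \<longlonglongrightarrow> 0"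
    using assms(1) by (auto simp: approximates_def)
  have le: "cmod (K (u n) x - F x) \<le> e n * seminorm x" for n
    using bounded_byD[of "\<lambda>v. F v - K (u n) v" "e n" x] e(1)[of n] assms(2)
    by (simp add: norm_minus_commute)
  have "(\<lambda>n. K (u n) x - F x) \<longlonglongrightarrow> 0"
  proof (rule Lim_null_comparison)
    show "(\<lambda>n. e n * seminorm x) \<longlonglongrightarrow> 0"
      using tendsto_mult_right[OF e(2), of "seminorm x"] by simp
  qed (simp add: always_eventually le)
  then show ?thesis by (rule LIM_zero_cancel)
qed

lemma completion_add_arg:
  assumes "F \<in> hilbert_completion" "v \<in> V" "w \<in> V"
  shows "F (v + w) = F v + F w"
proof -
  obtain u where u: "approximates u F" using completion_approximates[OF assms(1)] by blast
  have "(\<lambda>n. K (u n) (v + w)) \<longlonglongrightarrow> F v + F w"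
    using tendsto_add[OF approximates_pointwise[OF u assms(2)] approximates_pointwise[OF u assms(3)]]
      approximates_mem[OF u] assms by (simp add: K_add_right)
  then show ?thesis
    using approximates_pointwise[OF u add_V[OF assms(2,3)]] LIMSEQ_unique by blast
qed

lemma completion_scale_arg:
  assumes "F \<in> hilbert_completion" "v \<in> V"
  shows "F (c *\<^sub>C v) = cnj c * F v"
proof -
  obtain u where u: "approximates u F" using completion_approximates[OF assms(1)] by blast
  have "(\<lambda>n. K (u n) (c *\<^sub>C v)) \<longlonglongrightarrow> cnj c * F v"
    using tendsto_mult_left[OF approximates_pointwise[OF u assms(2)], of "cnj c"]
      approximates_mem[OF u] assms by (simp add: K_scaleC_right)
  then show ?thesis
    using approximates_pointwise[OF u scaleC_V[OF assms(2)]] LIMSEQ_unique by blast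
qed

lemma completion_diff_arg:
  assumes "F \<in> hilbert_completion" "v \<in> V" "w \<in> V"
  shows "F (v - w) = F v - F w"
  using completion_add_arg[OF assms(1) diff_V[OF assms(2,3)] assms(3)] by simp

lemma approximates_diff_tendsto:
  assumes "approximates v G" "approximates w G"
  shows "\<exists>e. e \<longlonglongrightarrow> 0 \<and> (\<forall>m n. seminorm (v m - w n) \<le> e m + e n)"
proof -
  obtain d where d: "\<And>n. v n \<in> V \<and> 0 \<le> d n \<and> bounded_by (\<lambda>x. G x - K (v n) x) (d n)" "d \<longlonglongrightarrow> 0"
    using assms(1) by (auto simp: approximates_def)
  obtain e where e: "\<And>n. w n \<in> V \<and> 0 \<le> e n \<and> bounded_by (\<lambda>x. G x - K (w n) x) (e n)" "e \<longlonglongrightarrow> 0"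
    using assms(2) by (auto simp: approximates_def)
  have "seminorm (v m - w n) \<le> d m + e m + (d n + e n)" for m n
  proof -
    have "bounded_by (\<lambda>x. (G x - K (w n) x) - (G x - K (v m) x)) (e n + d m)"
      using d(1) e(1) by (intro bounded_by_diff) auto
    then have "bounded_by (K (v m - w n)) (e n + d m)"
      using d(1) e(1) by (simp add: bounded_by_def K_diff_left)
    then have "seminorm (v m - w n) \<le> e n + d m"
      using d(1) e(1) by (intro seminorm_le) (auto intro: diff_V)
    then show ?thesis using d(1)[of n] e(1)[of m] by linarith
  qed
  moreover have "(\<lambda>n. d n + e n) \<longlonglongrightarrow> 0" using tendsto_add[OF d(2) e(2)] by simp
  ultimately show ?thesis by (intro exI[of _ "\<lambda>n. d n + e n"]) auto
qed

lemma completion_ip_limit: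
  assumes F: "F \<in> hilbert_completion" and w: "approximates w G"
  shows "(\<lambda>n. F (w n)) \<longlonglongrightarrow> completion_ip F G"
proof -
  define v where "v = (SOME v. approximates v G)"
  have v: "approximates v G" unfolding v_def by (rule someI[where P = "\<lambda>v. approximates v G", OF w])
  obtain C where C: "0 \<le> C" "bounded_by F C" using completion_bounded[OF F] .
  have le: "cmod (F x - F y) \<le> C * seminorm (x - y)" if "x \<in> V" "y \<in> V" for x y
    using bounded_byD[OF C(2) diff_V[OF that]] by (simp add: completion_diff_arg[OF F that])
  obtain d where d: "d \<longlonglongrightarrow> 0" "\<And>m n. seminorm (v m - v n) \<le> d m + d n"
    using approximates_diff_tendsto[OF v v] by blast
  have "Cauchy (\<lambda>n. F (v n))"
  proof (rule metric_CauchyI)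
    fix e :: real assume "0 < e"
    then have "0 < e / (2 * (C + 1))" using C by simp
    then obtain N where N: "\<And>n. n \<ge> N \<Longrightarrow> d n < e / (2 * (C + 1))"
      using order_tendstoD(2)[OF d(1)] by (auto simp: eventually_sequentially)
    have "dist (F (v m)) (F (v n)) < e" if "m \<ge> N" "n \<ge> N" for m n
    proof -
      have "dist (F (v m)) (F (v n)) \<le> C * seminorm (v m - v n)"
        unfolding dist_norm by (intro le approximates_mem[OF v])
      also have "\<dots> \<le> (C + 1) * seminorm (v m - v n)"
        using seminorm_nonneg[OF diff_V[OF approximates_mem[OF v] approximates_mem[OF v]]]
        by (intro mult_right_mono) auto
      also have "\<dots> \<le> (C + 1) * (d m + d n)" using d(2) C by (intro mult_left_mono) auto
      also have "\<dots> < (C + 1) * (e / (2 * (C + 1)) + e / (2 * (C + 1)))"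
        using N that C by (intro mult_strict_left_mono add_strict_mono) auto
      also have "\<dots> = e"
      proof -
        have cancel: "D * (e / (2 * D) + e / (2 * D)) = e" if "D \<noteq> 0" for D using that by (simp add: field_simps)
        show ?thesis by (rule cancel) (use C in simp)
      qed
      finally show ?thesis .
    qed
    then show "\<exists>N. \<forall>m\<ge>N. \<forall>n\<ge>N. dist (F (v m)) (F (v n)) < e" by blast
  qed
  then have conv: "(\<lambda>n. F (v n)) \<longlonglongrightarrow> completion_ip F G"
    unfolding completion_ip_def v_def[symmetric] by (simp add: Cauchy_convergent_iff convergent_LIMSEQ_iff)
  obtain d' where d': "d' \<longlonglongrightarrow> 0" "\<And>m n. seminorm (w m - v n) \<le> d' m + d' n"
    using approximates_diff_tendsto[OF w v] by blast
  have "(\<lambda>n. F (w n) - F (v n)) \<longlonglongrightarrow> 0"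
  proof (rule Lim_null_comparison)
    show "\<forall>\<^sub>F n in sequentially. norm (F (w n) - F (v n)) \<le> C * (d' n + d' n)"
      by (intro always_eventually allI order.trans[OF le mult_left_mono] approximates_mem[OF w]
          approximates_mem[OF v] d'(2) C(1))
    show "(\<lambda>n. C * (d' n + d' n)) \<longlonglongrightarrow> 0"
      using tendsto_mult_left[OF tendsto_add[OF d'(1) d'(1)], of C] by simp
  qed
  from tendsto_add[OF this conv] show ?thesis by simp
qed

lemma completion_ip_embed:
  assumes "F \<in> hilbert_completion" "v \<in> V"
  shows "completion_ip F (embed v) = F v"
  using completion_ip_limit[OF assms(1) approximates_embed[OF assms(2)]]
  by (simp add: LIMSEQ_const_iff)

lemma completion_ip_eq_limit_K:
  assumes F: "F \<in> hilbert_completion" and u: "approximates u F" and v: "approximates v G"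
  shows "(\<lambda>n. K (u n) (v n)) \<longlonglongrightarrow> completion_ip F G"
proof -
  obtain e where e: "\<And>n. u n \<in> V \<and> 0 \<le> e n \<and> bounded_by (\<lambda>v. F v - K (u n) v) (e n)" "e \<longlonglongrightarrow> 0"
    using u by (auto simp: approximates_def)
  obtain d where d: "\<And>n. v n \<in> V \<and> 0 \<le> d n \<and> bounded_by (\<lambda>x. G x - K (v n) x) (d n)" "d \<longlonglongrightarrow> 0"
    using v by (auto simp: approximates_def)
  have "seminorm (v n) \<le> seminorm (v 0) + d 0 + d n" for n
  proof (rule seminorm_le)
    have "bounded_by (\<lambda>x. (K (v 0) x + (G x - K (v 0) x)) - (G x - K (v n) x)) (seminorm (v 0) + d 0 + d n)"
      using d(1) by (intro bounded_by_diff bounded_by_add bounded_by_K) auto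
    then show "bounded_by (K (v n)) (seminorm (v 0) + d 0 + d n)" by simp
  qed (use d(1) seminorm_nonneg in auto)
  then have le: "cmod (F (v n) - K (u n) (v n)) \<le> e n * (seminorm (v 0) + d 0 + d n)" for n
    using bounded_byD[of "\<lambda>v. F v - K (u n) v" "e n" "v n"] e(1)[of n] d(1)[of n]
    by (meson mult_left_mono order.trans)
  have "(\<lambda>n. F (v n) - K (u n) (v n)) \<longlonglongrightarrow> 0"
  proof (rule Lim_null_comparison)
    show "(\<lambda>n. e n * (seminorm (v 0) + d 0 + d n)) \<longlonglongrightarrow> 0"
      using tendsto_mult[OF e(2) tendsto_add[OF tendsto_const d(2)]] by simp
  qed (simp_all add: always_eventually le)
  from tendsto_diff[OF completion_ip_limit[OF F v] this] show ?thesis by simp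
qed

definition completion_norm :: "('v \<Rightarrow> complex) \<Rightarrow> real" where
  "completion_norm F = sqrt (Re (completion_ip F F))"

lemma seminorm_tendsto_completion_norm:
  assumes "F \<in> hilbert_completion" "approximates u F"
  shows "(\<lambda>n. seminorm (u n)) \<longlonglongrightarrow> completion_norm F"
  unfolding seminorm_def completion_norm_def
  by (intro tendsto_real_sqrt tendsto_Re completion_ip_eq_limit_K assms)

text \<open>Together with \<open>completion_norm_le\<close> this identifies the norm of the completion with the dual norm. It
  gives definiteness, and it reduces completeness to pointwise limits of functionals.\<close>

lemma bounded_by_completion_norm:
  assumes "F \<in> hilbert_completion"
  shows "bounded_by F (completion_norm F)"
  unfolding bounded_by_def
proof
  fix v assume v: "v \<in> V"
  obtain u where u: "approximates u F" using completion_approximates[OF assms] by blast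
  then obtain e where e: "\<And>n. u n \<in> V \<and> 0 \<le> e n \<and> bounded_by (\<lambda>v. F v - K (u n) v) (e n)" "e \<longlonglongrightarrow> 0"
    by (auto simp: approximates_def)
  have "bounded_by (\<lambda>v. (F v - K (u n) v) + K (u n) v) (e n + seminorm (u n))" for n
    using e(1) by (intro bounded_by_add bounded_by_K) auto
  then have le: "cmod (F v) \<le> (e n + seminorm (u n)) * seminorm v" for n
    using bounded_byD[OF _ v] by fastforce
  have "(\<lambda>n. (e n + seminorm (u n)) * seminorm v) \<longlonglongrightarrow> (0 + completion_norm F) * seminorm v"
    by (intro tendsto_intros e seminorm_tendsto_completion_norm[OF assms u])
  then show "cmod (F v) \<le> completion_norm F * seminorm v"
    using LIMSEQ_le_const le by fastforce
qed

lemma completion_norm_nonneg: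
  assumes "F \<in> hilbert_completion"
  shows "0 \<le> completion_norm F"
proof -
  obtain u where u: "approximates u F" using completion_approximates[OF assms] by blast
  have "0 \<le> seminorm (u n)" for n by (intro seminorm_nonneg approximates_mem[OF u])
  then show ?thesis
    using LIMSEQ_le_const[OF seminorm_tendsto_completion_norm[OF assms u]] by blast
qed

lemma completion_norm_le:
  assumes "F \<in> hilbert_completion" "bounded_by F C" "0 \<le> C"
  shows "completion_norm F \<le> C"
proof -
  obtain u where u: "approximates u F" using completion_approximates[OF assms(1)] by blast
  then obtain e where e: "\<And>n. u n \<in> V \<and> 0 \<le> e n \<and> bounded_by (\<lambda>v. F v - K (u n) v) (e n)" "e \<longlonglongrightarrow> 0"
    by (auto simp: approximates_def)
  have "seminorm (u n) \<le> C + e n" for n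
  proof (rule seminorm_le)
    have "bounded_by (\<lambda>v. F v - (F v - K (u n) v)) (C + e n)"
      using e(1) assms(2) by (intro bounded_by_diff) auto
    then show "bounded_by (K (u n)) (C + e n)" by simp
  qed (use e(1) assms(3) in auto)
  moreover have "(\<lambda>n. C + e n) \<longlonglongrightarrow> C + 0" by (intro tendsto_intros e)
  ultimately show ?thesis
    using LIMSEQ_le[OF seminorm_tendsto_completion_norm[OF assms(1) u]] by fastforce
qed

lemma completion_add:
  assumes "F \<in> hilbert_completion" "G \<in> hilbert_completion"
  shows "(\<lambda>v. F v + G v) \<in> hilbert_completion"
proof -
  obtain u v where "approximates u F" "approximates v G" using completion_approximates assms by metis
  from approximates_add[OF this] show ?thesis
    using assms by (intro approximates_imp_completion) (auto simp: hilbert_completionD)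
qed

lemma completion_scale:
  assumes "F \<in> hilbert_completion"
  shows "(\<lambda>v. c * F v) \<in> hilbert_completion"
proof -
  obtain u where "approximates u F" using completion_approximates[OF assms] by blast
  from approximates_scale[OF this] show ?thesis
    using assms by (intro approximates_imp_completion) (auto simp: hilbert_completionD)
qed

lemma completion_hilbert_space: "hilbert_space_on hilbert_completion completion_ip"
proof
  have "(0 :: 'v \<Rightarrow> complex) = embed 0"
    by (auto simp: fun_eq_iff embed_def K_zero_left)
  then show "(0 :: 'v \<Rightarrow> complex) \<in> hilbert_completion" using embed_in_completion[OF zero_V] by simp
next
  fix F G assume "F \<in> hilbert_completion" "G \<in> hilbert_completion"
  then show "F + G \<in> hilbert_completion" using completion_add by (simp add: plus_fun_def)
next
  fix F c assume "F \<in> hilbert_completion"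
  then show "c *\<^sub>C F \<in> hilbert_completion" using completion_scale by (simp add: scaleC_fun_def scaleC_complex_def)
next
  fix F G assume FG: "F \<in> hilbert_completion" "G \<in> hilbert_completion"
  obtain u v where uv: "approximates u F" "approximates v G"
    using completion_approximates FG by metis
  have "(\<lambda>n. cnj (K (v n) (u n))) \<longlonglongrightarrow> cnj (completion_ip G F)"
    by (intro tendsto_cnj completion_ip_eq_limit_K FG uv)
  then have "(\<lambda>n. K (u n) (v n)) \<longlonglongrightarrow> cnj (completion_ip G F)"
    using uv by (simp add: approximates_mem flip: K_commute)
  then show "completion_ip F G = cnj (completion_ip G F)"
    using completion_ip_eq_limit_K[OF FG(1) uv] LIMSEQ_unique by blast
next
  fix F G H assume FGH: "F \<in> hilbert_completion" "G \<in> hilbert_completion" "H \<in> hilbert_completion"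
  obtain w where w: "approximates w H" using completion_approximates[OF FGH(3)] by blast
  have "F + G \<in> hilbert_completion" using completion_add[OF FGH(1,2)] by (simp add: plus_fun_def)
  then show "completion_ip (F + G) H = completion_ip F H + completion_ip G H"
    using tendsto_add[OF completion_ip_limit[OF FGH(1) w] completion_ip_limit[OF FGH(2) w]]
      completion_ip_limit[OF _ w, of "F + G"] LIMSEQ_unique by (auto simp: plus_fun_def)
next
  fix F G c assume FG: "F \<in> hilbert_completion" "G \<in> hilbert_completion"
  obtain w where w: "approximates w G" using completion_approximates[OF FG(2)] by blast
  have eq: "c *\<^sub>C F = (\<lambda>v. c * F v)" by (simp add: scaleC_fun_def scaleC_complex_def)
  show "completion_ip (c *\<^sub>C F) G = c * completion_ip F G"
    unfolding eq
    using tendsto_mult_left[OF completion_ip_limit[OF FG(1) w], of c]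
      completion_ip_limit[OF completion_scale[OF FG(1)] w, of c] LIMSEQ_unique by blast
next
  fix F assume F: "F \<in> hilbert_completion" "F \<noteq> 0"
  then obtain v where v: "F v \<noteq> 0" by (auto simp: fun_eq_iff)
  then have "v \<in> V" using hilbert_completionD F by blast
  then have "cmod (F v) \<le> completion_norm F * seminorm v"
    using bounded_byD[OF bounded_by_completion_norm[OF F(1)]] by blast
  then have "completion_norm F \<noteq> 0" using v by auto
  then have "0 < completion_norm F" using completion_norm_nonneg[OF F(1)] by simp
  then show "0 < Re (completion_ip F F)" by (simp add: completion_norm_def)
next
  fix X :: "nat \<Rightarrow> 'v \<Rightarrow> complex"
  assume X: "\<And>n. X n \<in> hilbert_completion"
    and cauchy: "\<And>e. 0 < e \<Longrightarrow>
      \<exists>N. \<forall>m\<ge>N. \<forall>n\<ge>N. sqrt (Re (completion_ip (X m - X n) (X m - X n))) < e"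
  have diff: "(\<lambda>v. F v - G v) \<in> hilbert_completion" if "F \<in> hilbert_completion" "G \<in> hilbert_completion" for F G
    using completion_add[OF that(1) completion_scale[OF that(2), of "-1"]] by simp
  have minus: "F - G = (\<lambda>v. F v - G v)" for F G :: "'v \<Rightarrow> complex" by (simp add: fun_eq_iff)
  have bd: "\<exists>N. \<forall>m\<ge>N. \<forall>n\<ge>N. bounded_by (\<lambda>v. X m v - X n v) e" if "0 < e" for e
  proof -
    have "\<exists>N. \<forall>m\<ge>N. \<forall>n\<ge>N. completion_norm (\<lambda>v. X m v - X n v) < e"
      using cauchy[OF that] unfolding minus completion_norm_def .
    then show ?thesis
      using bounded_by_mono[OF bounded_by_completion_norm[OF diff[OF X X]]] less_imp_le by blast
  qed
  define F where "F v = lim (\<lambda>n. X n v)" for v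
  have F: "(\<lambda>n. X n v) \<longlonglongrightarrow> F v" for v
  proof (cases "v \<in> V")
    case True
    have "Cauchy (\<lambda>n. X n v)"
    proof (rule metric_CauchyI)
      fix e :: real assume "0 < e"
      then have "0 < e / (seminorm v + 1)" using seminorm_nonneg[OF True] by simp
      then obtain N where N: "\<And>m n. m \<ge> N \<Longrightarrow> n \<ge> N \<Longrightarrow> bounded_by (\<lambda>v. X m v - X n v) (e / (seminorm v + 1))"
        using bd by meson
      have "dist (X m v) (X n v) < e" if "m \<ge> N" "n \<ge> N" for m n
      proof -
        have "dist (X m v) (X n v) \<le> e / (seminorm v + 1) * seminorm v"
          using bounded_byD[OF N[OF that] True] by (simp add: dist_norm)
        also have "\<dots> < e" using \<open>0 < e\<close> seminorm_nonneg[OF True] by (simp add: field_simps)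
        finally show ?thesis .
      qed
      then show "\<exists>N. \<forall>m\<ge>N. \<forall>n\<ge>N. dist (X m v) (X n v) < e" by blast
    qed
    then show ?thesis by (simp add: F_def Cauchy_convergent_iff convergent_LIMSEQ_iff)
  next
    case False
    then show ?thesis using hilbert_completionD[OF X] by (simp add: F_def lim_def LIMSEQ_const_iff)
  qed
  have F_bd: "\<exists>N. \<forall>n\<ge>N. bounded_by (\<lambda>v. X n v - F v) e" if "0 < e" for e
  proof -
    obtain N where N: "\<And>m n. m \<ge> N \<Longrightarrow> n \<ge> N \<Longrightarrow> bounded_by (\<lambda>v. X m v - X n v) e"
      using bd[OF \<open>0 < e\<close>] by blast
    have "cmod (X n v - F v) \<le> e * seminorm v" if "n \<ge> N" "v \<in> V" for n v
    proof (rule LIMSEQ_le_const2)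
      show "(\<lambda>m. cmod (X n v - X m v)) \<longlonglongrightarrow> cmod (X n v - F v)" by (intro tendsto_intros F)
      show "\<exists>N. \<forall>m\<ge>N. cmod (X n v - X m v) \<le> e * seminorm v"
        using N that bounded_byD by blast
    qed
    then show ?thesis by (auto simp: bounded_by_def)
  qed
  have "F \<in> hilbert_completion"
    unfolding hilbert_completion_def
  proof (intro CollectI conjI allI impI)
    fix v assume "v \<notin> V"
    then show "F v = 0" using F[of v] hilbert_completionD[OF X] by (simp add: LIMSEQ_const_iff)
  next
    fix e :: real assume e: "0 < e"
    then obtain n where n: "bounded_by (\<lambda>v. X n v - F v) (e / 2)" using F_bd[of "e / 2"] by auto
    obtain u where u: "u \<in> V" "bounded_by (\<lambda>v. X n v - K u v) (e / 2)"
      using X[of n] half_gt_zero[OF e] unfolding hilbert_completion_def by blast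
    have "bounded_by (\<lambda>v. (X n v - K u v) - (X n v - F v)) (e / 2 + e / 2)"
      by (intro bounded_by_diff u n)
    then show "\<exists>u\<in>V. bounded_by (\<lambda>v. F v - K u v) e" using u(1) by auto
  qed
  moreover have "(\<lambda>n. completion_norm (\<lambda>v. X n v - F v)) \<longlonglongrightarrow> 0"
  proof (rule LIMSEQ_I)
    fix e :: real assume e: "0 < e"
    then obtain N where "\<And>n. n \<ge> N \<Longrightarrow> bounded_by (\<lambda>v. X n v - F v) (e / 2)"
      using F_bd[of "e / 2"] by auto
    then have "completion_norm (\<lambda>v. X n v - F v) \<le> e / 2" if "n \<ge> N" for n
      using that e by (intro completion_norm_le diff X \<open>F \<in> hilbert_completion\<close>) auto
    then show "\<exists>N. \<forall>n\<ge>N. norm (completion_norm (\<lambda>v. X n v - F v) - 0) < e"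
      using e completion_norm_nonneg[OF diff[OF X \<open>F \<in> hilbert_completion\<close>]]
      by (intro exI[of _ N]) (auto simp: order.strict_trans1[of _ "e / 2" e])
  qed
  ultimately show "\<exists>l\<in>hilbert_completion. (\<lambda>n. sqrt (Re (completion_ip (X n - l) (X n - l)))) \<longlonglongrightarrow> 0"
    unfolding minus completion_norm_def by blast
qed

text \<open>A bijective isometry $\sigma$ of \<open>V\<close> with inverse $\tau$ acts on functionals by composition with
  $\tau$, because $K(\sigma u, v) = K(u, \tau v)$.\<close>

definition pullback :: "('v \<Rightarrow> 'v) \<Rightarrow> ('v \<Rightarrow> complex) \<Rightarrow> 'v \<Rightarrow> complex" where
  "pullback \<tau> F = (\<lambda>v. if v \<in> V then F (\<tau> v) else 0)"

context
  fixes \<sigma> \<tau> :: "'v \<Rightarrow> 'v"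
  assumes \<sigma>: "\<And>v. v \<in> V \<Longrightarrow> \<sigma> v \<in> V" and \<tau>: "\<And>v. v \<in> V \<Longrightarrow> \<tau> v \<in> V"
    and inverse: "\<And>v. v \<in> V \<Longrightarrow> \<tau> (\<sigma> v) = v" "\<And>v. v \<in> V \<Longrightarrow> \<sigma> (\<tau> v) = v"
    and isometric: "\<And>u v. u \<in> V \<Longrightarrow> v \<in> V \<Longrightarrow> K (\<sigma> u) (\<sigma> v) = K u v"
begin

lemma K_shift: "u \<in> V \<Longrightarrow> v \<in> V \<Longrightarrow> K (\<sigma> u) v = K u (\<tau> v)"
  using isometric[OF _ \<tau>] inverse(2) by metis

lemma seminorm_shift: "v \<in> V \<Longrightarrow> seminorm (\<tau> v) = seminorm v"
  using isometric[OF \<tau> \<tau>] inverse(2) by (simp add: seminorm_def)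

lemma pullback_approximates:
  assumes "approximates u F"
  shows "approximates (\<lambda>n. \<sigma> (u n)) (pullback \<tau> F)"
proof -
  obtain e where e: "\<And>n. u n \<in> V \<and> 0 \<le> e n \<and> bounded_by (\<lambda>v. F v - K (u n) v) (e n)" "e \<longlonglongrightarrow> 0"
    using assms by (auto simp: approximates_def)
  have "bounded_by (\<lambda>v. pullback \<tau> F v - K (\<sigma> (u n)) v) (e n)" for n
    unfolding bounded_by_def
  proof
    fix v assume v: "v \<in> V"
    show "cmod (pullback \<tau> F v - K (\<sigma> (u n)) v) \<le> e n * seminorm v"
      using bounded_byD[of "\<lambda>v. F v - K (u n) v" "e n" "\<tau> v"] e(1)[of n] v
      by (simp add: pullback_def K_shift seminorm_shift \<tau>)
  qed
  then show ?thesis using e \<sigma> by (auto simp: approximates_def)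
qed

lemma pullback_in_completion:
  assumes "F \<in> hilbert_completion"
  shows "pullback \<tau> F \<in> hilbert_completion"
proof -
  obtain u where "approximates u F" using completion_approximates[OF assms] by blast
  from pullback_approximates[OF this] show ?thesis
    by (rule approximates_imp_completion[rotated]) (simp add: pullback_def)
qed

lemma pullback_embed: "u \<in> V \<Longrightarrow> pullback \<tau> (embed u) = embed (\<sigma> u)"
  by (auto simp: pullback_def embed_def fun_eq_iff K_shift \<tau>)

lemma pullback_ip:
  assumes "F \<in> hilbert_completion" "G \<in> hilbert_completion"
  shows "completion_ip (pullback \<tau> F) (pullback \<tau> G) = completion_ip F G"
proof -
  obtain w where w: "approximates w G" using completion_approximates[OF assms(2)] by blast
  have "(\<lambda>n. pullback \<tau> F (\<sigma> (w n))) \<longlonglongrightarrow> completion_ip (pullback \<tau> F) (pullback \<tau> G)"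
    by (rule completion_ip_limit[OF pullback_in_completion[OF assms(1)] pullback_approximates[OF w]])
  moreover have "pullback \<tau> F (\<sigma> (w n)) = F (w n)" for n
    using approximates_mem[OF w] \<sigma> inverse by (simp add: pullback_def)
  ultimately show ?thesis using completion_ip_limit[OF assms(1) w] LIMSEQ_unique by simp
qed

end

lemma unitary_on_pullback:
  assumes \<sigma>: "\<And>v. v \<in> V \<Longrightarrow> \<sigma> v \<in> V" and \<tau>: "\<And>v. v \<in> V \<Longrightarrow> \<tau> v \<in> V"
    and inverse: "\<And>v. v \<in> V \<Longrightarrow> \<tau> (\<sigma> v) = v" "\<And>v. v \<in> V \<Longrightarrow> \<sigma> (\<tau> v) = v"
    and isometric: "\<And>u v. u \<in> V \<Longrightarrow> v \<in> V \<Longrightarrow> K (\<sigma> u) (\<sigma> v) = K u v"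
  shows "unitary_on hilbert_completion completion_ip (pullback \<tau>)"
  unfolding unitary_on_def
proof (intro conjI ballI allI)
  have isometric': "K (\<tau> u) (\<tau> v) = K u v" if "u \<in> V" "v \<in> V" for u v
    using isometric[OF \<tau> \<tau>] inverse(2) that by simp
  have "pullback \<sigma> (pullback \<tau> F) = F" "pullback \<tau> (pullback \<sigma> F) = F" if "F \<in> hilbert_completion" for F
    using that \<sigma> \<tau> inverse hilbert_completionD[OF that] by (auto simp: pullback_def fun_eq_iff)
  moreover have "pullback \<tau> F \<in> hilbert_completion" "pullback \<sigma> F \<in> hilbert_completion"
    if "F \<in> hilbert_completion" for F
    using pullback_in_completion[OF \<sigma> \<tau> inverse isometric that]
      pullback_in_completion[OF \<tau> \<sigma> inverse(2,1) isometric' that] by simp_all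
  ultimately show "bij_betw (pullback \<tau>) hilbert_completion hilbert_completion"
    by (intro bij_betw_byWitness[where f' = "pullback \<sigma>"]) auto
qed (auto simp: pullback_def fun_eq_iff scaleC_fun_def scaleC_complex_def
    pullback_ip[OF \<sigma> \<tau> inverse isometric, unfolded pullback_def])

end

section \<open>Constructing the dilation\<close>

text \<open>The real part of \<open>f\<close> is a bounded real functional; its representing vector also gives the
  imaginary part, which is the real part at \<open>\<i> *\<^sub>C x\<close>.\<close>

lemma riesz_representation_antilinear:
  fixes f :: "'a::chilbert_space \<Rightarrow> complex"
  assumes add: "\<And>x y. f (x + y) = f x + f y" and scale: "\<And>c x. f (c *\<^sub>C x) = cnj c * f x"
    and bounded: "\<And>x. cmod (f x) \<le> C * norm x"
  shows "\<exists>a. \<forall>x. f x = cinner a x"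
proof -
  have "bounded_linear (\<lambda>x. Re (f x))"
  proof (rule bounded_linear_intro[where K = C])
    show "norm (Re (f x)) \<le> norm x * C" for x
      using bounded[of x] abs_Re_le_cmod[of "f x"] by (simp add: mult.commute)
  qed (simp_all add: add scale scaleR_scaleC)
  then obtain a where "\<And>x. Re (f x) = inner x a" using riesz_representation_real by blast
  then have Re: "Re (f x) = Re (cinner a x)" for x
    using inner_commute[of x a] by (simp only: inner_eq_Re_cinner)
  have "f x = cinner a x" for x
    using Re[of x] Re[of "\<i> *\<^sub>C x"] by (simp add: scale cinner_scaleC_right complex_eq_iff)
  then show ?thesis by blast
qed

definition support :: "(int \<Rightarrow> 'a::zero) \<Rightarrow> int set" where
  "support u = {i. u i \<noteq> 0}"

text \<open>The inner product $\langle\sum_i U^i J u_i, \sum_j U^j J v_j\rangle$ that a $\rho$-dilation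
  \<open>U\<close> of \<open>A\<close> would have to produce.\<close>

definition toeplitz_form ::
  "real \<Rightarrow> ('a::chilbert_space \<Rightarrow> 'a) \<Rightarrow> (int \<Rightarrow> 'a) \<Rightarrow> (int \<Rightarrow> 'a) \<Rightarrow> complex" where
  "toeplitz_form \<rho> A u v = (\<Sum>i\<in>support u. \<Sum>j\<in>support v. toeplitz_kernel \<rho> A (i - j) (u i) (v j))"

definition delta :: "int \<Rightarrow> 'a::zero \<Rightarrow> int \<Rightarrow> 'a" where
  "delta n x = (\<lambda>i. if i = n then x else 0)"

context
  fixes A :: "'a::chilbert_space \<Rightarrow> 'a" and \<rho> :: real
  assumes A: "bounded_clinear A"
begin

lemma toeplitz_kernel_zero:
  "toeplitz_kernel \<rho> A n 0 y = 0" "toeplitz_kernel \<rho> A n x 0 = 0"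
  using linear_0[OF linear_funpow[OF bounded_clinear_linear[OF A]]]
  by (simp_all add: toeplitz_kernel_def)

lemma toeplitz_form_eq:
  assumes "finite I" "support u \<subseteq> I" "finite J" "support v \<subseteq> J"
  shows "toeplitz_form \<rho> A u v = (\<Sum>i\<in>I. \<Sum>j\<in>J. toeplitz_kernel \<rho> A (i - j) (u i) (v j))"
proof -
  have "toeplitz_form \<rho> A u v = (\<Sum>i\<in>support u. \<Sum>j\<in>J. toeplitz_kernel \<rho> A (i - j) (u i) (v j))"
    unfolding toeplitz_form_def
    by (intro sum.cong refl sum.mono_neutral_left assms) (auto simp: support_def toeplitz_kernel_zero)
  also have "\<dots> = (\<Sum>i\<in>I. \<Sum>j\<in>J. toeplitz_kernel \<rho> A (i - j) (u i) (v j))"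
    by (intro sum.mono_neutral_left assms) (auto simp: support_def toeplitz_kernel_zero)
  finally show ?thesis .
qed

lemma toeplitz_form_delta: "toeplitz_form \<rho> A (delta m x) (delta n y) = toeplitz_kernel \<rho> A (m - n) x y"
proof -
  have "support (delta k z) \<subseteq> {k}" for k and z :: 'a by (auto simp: support_def delta_def)
  from toeplitz_form_eq[OF _ this _ this] show ?thesis by (simp add: delta_def)
qed

lemma semi_inner_space_toeplitz:
  assumes \<rho>: "\<rho> \<ge> 1" and dil: "dilation_inequality \<rho> A"
  shows "semi_inner_space {u. finite (support u)} (toeplitz_form \<rho> A)"
proof
  show "(0 :: int \<Rightarrow> 'a) \<in> {u. finite (support u)}" by (simp add: support_def)
next
  fix u v :: "int \<Rightarrow> 'a" assume uv: "u \<in> {u. finite (support u)}" "v \<in> {u. finite (support u)}"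
  have "support (u + v) \<subseteq> support u \<union> support v" by (auto simp: support_def)
  then show "u + v \<in> {u. finite (support u)}" using uv by (auto intro: finite_subset)
next
  fix u :: "int \<Rightarrow> 'a" and c assume u: "u \<in> {u. finite (support u)}"
  have "support (c *\<^sub>C u) \<subseteq> support u" by (auto simp: support_def scaleC_fun_def scaleC_zero_right)
  then show "c *\<^sub>C u \<in> {u. finite (support u)}" using u by (auto intro: finite_subset)
next
  fix u v :: "int \<Rightarrow> 'a" assume "u \<in> {u. finite (support u)}" "v \<in> {u. finite (support u)}"
  show "toeplitz_form \<rho> A u v = cnj (toeplitz_form \<rho> A v u)"
    unfolding toeplitz_form_def cnj_sum
    by (subst sum.swap) (simp add: toeplitz_kernel_commute[of \<rho> A "i - j" "u i" for i j])
next
  fix u v w :: "int \<Rightarrow> 'a"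
  assume fin: "u \<in> {u. finite (support u)}" "v \<in> {u. finite (support u)}" "w \<in> {u. finite (support u)}"
  define I where "I = support u \<union> support v"
  have I: "finite I" "support u \<subseteq> I" "support v \<subseteq> I" "support (u + v) \<subseteq> I"
    using fin by (auto simp: I_def support_def)
  show "toeplitz_form \<rho> A (u + v) w = toeplitz_form \<rho> A u w + toeplitz_form \<rho> A v w"
    using fin I
    by (simp add: toeplitz_form_eq[of I _ "support w"] toeplitz_kernel_add_left[OF A] sum.distrib)
next
  fix u v :: "int \<Rightarrow> 'a" and c
  assume fin: "u \<in> {u. finite (support u)}" "v \<in> {u. finite (support u)}"
  have I: "support (c *\<^sub>C u) \<subseteq> support u" by (auto simp: support_def scaleC_fun_def scaleC_zero_right)
  show "toeplitz_form \<rho> A (c *\<^sub>C u) v = c * toeplitz_form \<rho> A u v"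
    using fin I
    by (simp add: toeplitz_form_eq[of "support u" _ "support v"] scaleC_fun_def
        toeplitz_kernel_scaleC_left[OF A] sum_distrib_left)
next
  fix u :: "int \<Rightarrow> 'a" assume "u \<in> {u. finite (support u)}"
  then have fin: "finite (support u)" by simp
  define m where "m = Max (insert 0 ((\<lambda>i. nat \<bar>i\<bar>) ` support u))"
  have "nat \<bar>i\<bar> \<le> m" if "i \<in> support u" for i
    unfolding m_def using fin that by (intro Max_ge) auto
  then have sub: "support u \<subseteq> {- int m..int m}" by fastforce
  show "0 \<le> Re (toeplitz_form \<rho> A u u)"
    unfolding toeplitz_form_eq[OF _ sub _ sub, simplified]
    by (rule toeplitz_form_nonneg[OF A \<rho> dil])
qed

lemma toeplitz_form_shift:
  "toeplitz_form \<rho> A (\<lambda>i. u (i - 1)) (\<lambda>i. v (i - 1)) = toeplitz_form \<rho> A u v"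
proof -
  have supp: "support (\<lambda>i. w (i - 1)) = (\<lambda>i. i + 1) ` support w" for w :: "int \<Rightarrow> 'a"
    by (force simp: support_def image_iff)
  show ?thesis
    unfolding toeplitz_form_def supp by (simp add: sum.reindex inj_on_def)
qed

end

text \<open>This is Naimark's construction. The dilation space is the completion of the finitely supported
  sequences under the Toeplitz form, \<open>U\<close> extends the bilateral shift \<open>\<sigma>\<close>, which preserves the form
  because the kernel depends on the difference of the indices only, and \<open>H\<close> sits at the index \<open>0\<close>.
  An element of the completion is a functional \<open>F\<close>, and its inner product with \<open>J x\<close> is
  \<open>F (delta 0 x)\<close>; so the projection onto \<open>H\<close> is the Riesz representation of
  \<open>x \<mapsto> F (delta 0 x)\<close>. Finally \<open>U ^^ n\<close> moves \<open>J x\<close> to the index \<open>n\<close>, whose Toeplitz entry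
  against the index \<open>0\<close> is \<open>A ^^ n\<close> divided by \<open>\<rho>\<close>.\<close>

lemma dilation_inequality_imp_rho_contraction:
  fixes A :: "'a::chilbert_space \<Rightarrow> 'a"
  assumes A: "bounded_clinear A" and \<rho>: "\<rho> \<ge> 1" and dil: "dilation_inequality \<rho> A"
  shows "rho_contraction \<rho> A"
proof -
  define V where "V = {u :: int \<Rightarrow> 'a. finite (support u)}"
  interpret semi_inner_space V "toeplitz_form \<rho> A"
    unfolding V_def by (rule semi_inner_space_toeplitz[OF A \<rho> dil])
  interpret H: hilbert_space_on hilbert_completion completion_ip
    by (rule completion_hilbert_space)
  define \<sigma> \<tau> where "\<sigma> u = (\<lambda>i. u (i - 1))" and "\<tau> u = (\<lambda>i. u (i + 1))" for u :: "int \<Rightarrow> 'a"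
  have shift: "(\<lambda>i. u (i + k)) \<in> V" if "u \<in> V" for u and k :: int
  proof -
    have "support (\<lambda>i. u (i + k)) \<subseteq> (\<lambda>i. i - k) ` support u" by (force simp: support_def image_iff)
    then show ?thesis using that by (auto simp: V_def intro: finite_surj)
  qed
  have \<sigma>: "\<sigma> u \<in> V" and \<tau>: "\<tau> u \<in> V" if "u \<in> V" for u
    using shift[OF that, of "-1"] shift[OF that, of 1] by (simp_all add: \<sigma>_def \<tau>_def)
  have inverse: "\<tau> (\<sigma> u) = u" "\<sigma> (\<tau> u) = u" for u by (simp_all add: \<sigma>_def \<tau>_def)
  have isometric: "toeplitz_form \<rho> A (\<sigma> u) (\<sigma> v) = toeplitz_form \<rho> A u v" for u v
    unfolding \<sigma>_def by (rule toeplitz_form_shift[OF A])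
  define U where "U = pullback \<tau>"
  have uni: "unitary_on hilbert_completion completion_ip U"
    unfolding U_def by (rule unitary_on_pullback[OF \<sigma> \<tau> inverse isometric])
  define J where "J x = embed (delta 0 x)" for x
  have delta: "delta n x \<in> V" for n x
    using finite_subset[of "support (delta n x)" "{n}"] by (auto simp: V_def support_def delta_def)
  have delta_add: "delta n (x + y) = delta n x + delta n y" for n and x y :: 'a
    by (auto simp: delta_def fun_eq_iff)
  have delta_scale: "delta n (c *\<^sub>C x) = c *\<^sub>C delta n x" for n c and x :: 'a
    by (auto simp: delta_def fun_eq_iff scaleC_fun_def scaleC_zero_right)
  have JS: "J x \<in> hilbert_completion" for x unfolding J_def by (rule embed_in_completion[OF delta])
  have ip_J: "completion_ip F (J x) = F (delta 0 x)" if "F \<in> hilbert_completion" for F x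
    unfolding J_def by (rule completion_ip_embed[OF that delta])
  have form_delta: "toeplitz_form \<rho> A (delta n x) (delta 0 y) = toeplitz_kernel \<rho> A n x y" for n x y
    by (simp add: toeplitz_form_delta[OF A])
  have J_delta: "J x (delta 0 y) = cinner x y" for x y
    using delta by (simp add: J_def embed_def form_delta toeplitz_kernel_def)
  have emb: "isometric_embedding hilbert_completion completion_ip J"
    unfolding isometric_embedding_def
  proof (intro conjI allI)
    show "range J \<subseteq> hilbert_completion" using JS by auto
    show "J (x + y) = J x + J y" for x y
      using delta by (auto simp: J_def embed_def delta_add K_add_left fun_eq_iff)
    show "J (c *\<^sub>C x) = c *\<^sub>C J x" for c x
      using delta by (auto simp: J_def embed_def delta_scale K_scaleC_left fun_eq_iff
          scaleC_fun_def[of _ "embed _", unfolded embed_def] scaleC_complex_def)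
    show "completion_ip (J x) (J y) = cinner x y" for x y by (simp add: ip_J JS J_delta)
  qed
  have "\<exists>a. \<forall>x. F (delta 0 x) = cinner a x" if F: "F \<in> hilbert_completion" for F
  proof -
    obtain C where C: "0 \<le> C" "bounded_by F C" using completion_bounded[OF F] .
    have "seminorm (delta 0 x) = norm x" for x
      by (simp add: seminorm_def form_delta toeplitz_kernel_def cinner_self del: of_real_power)
    then have "cmod (F (delta 0 x)) \<le> C * norm x" for x
      using bounded_byD[OF C(2) delta, of 0 x] by simp
    then show ?thesis
      by (intro riesz_representation_antilinear)
        (simp_all add: delta_add delta_scale completion_add_arg[OF F] completion_scale_arg[OF F] delta)
  qed
  then obtain R where R: "\<And>F x. F \<in> hilbert_completion \<Longrightarrow> F (delta 0 x) = cinner (R F) x" by metis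
  define P where "P F = J (R F)" for F
  have P: "orthogonal_projection_on hilbert_completion completion_ip (range J) P"
    unfolding orthogonal_projection_on_def
  proof (intro ballI conjI)
    fix F m assume F: "F \<in> hilbert_completion" and "m \<in> range J"
    then obtain x where m: "m = J x" by blast
    have "F - P F \<in> hilbert_completion" unfolding P_def by (rule H.diff_mem[OF F JS])
    then show "completion_ip (F - P F) m = 0" by (simp add: m ip_J P_def R[OF F] J_delta)
  qed (simp add: P_def)
  have pow: "(U ^^ n) (J x) = embed (delta (int n) x)" for n x
  proof (induction n)
    case (Suc n)
    have "\<sigma> (delta (int n) x) = delta (int (Suc n)) x" by (auto simp: \<sigma>_def delta_def fun_eq_iff)
    then show ?case
      using Suc pullback_embed[OF \<sigma> \<tau> inverse isometric delta, of "int n" x] by (simp add: U_def)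
  qed (simp add: J_def)
  have "J ((A ^^ n) x) = complex_of_real \<rho> *\<^sub>C P ((U ^^ n) (J x))" if n: "n \<ge> 1" for n x
  proof -
    define F where "F = (U ^^ n) (J x)"
    have F: "F \<in> hilbert_completion" unfolding F_def pow by (rule embed_in_completion[OF delta])
    have "cinner (R F) y = cinner ((1 / \<rho>) *\<^sub>R (A ^^ n) x) y" for y
      unfolding R[OF F, symmetric] unfolding F_def pow using n delta
      by (simp add: embed_def form_delta toeplitz_kernel_def cinner_scaleR_left)
    then have "cinner (R F - (1 / \<rho>) *\<^sub>R (A ^^ n) x) (R F - (1 / \<rho>) *\<^sub>R (A ^^ n) x) = 0"
      by (simp only: cinner_diff_left) simp
    then have "R F = (1 / \<rho>) *\<^sub>R (A ^^ n) x"
      by (simp only: cinner_self of_real_eq_0_iff power_eq_0_iff norm_eq_zero right_minus_eq)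
    then have "(A ^^ n) x = complex_of_real \<rho> *\<^sub>C R F"
      using \<rho> by (simp flip: scaleR_scaleC)
    then show ?thesis
      using emb unfolding P_def F_def[symmetric] isometric_embedding_def by simp
  qed
  then have "unitary_rho_dilation \<rho> A hilbert_completion completion_ip J U"
    unfolding unitary_rho_dilation_def using H.hilbert_space_on_axioms emb uni P by blast
  then show ?thesis by (rule unitary_rho_dilation_imp_rho_contraction)
qed


section \<open>The characterization\<close>

theorem theorem2p2:
  fixes \<rho> :: real and A :: "'a::chilbert_space \<Rightarrow> 'a"
  assumes "\<rho> \<ge> 1"
    and "bounded_clinear A"
    and "op_spectrum A \<subseteq> ball 0 1"
  shows "rho_contraction \<rho> A \<longleftrightarrow>
    (\<forall>z\<in>cball 0 1.
      positive_op (\<lambda>x.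
        x - (2 * (1 - 1 / \<rho>)) *\<^sub>R Re_op (\<lambda>y. cnj z *\<^sub>C A y) x
          - (1 / \<rho>\<^sup>2 - (1 - 1 / \<rho>)\<^sup>2 * (cmod z)\<^sup>2) *\<^sub>R cadjoint A (A x)))"
  unfolding positive_op_iff_resolvent_estimate[OF assms(2,1)]
proof
  assume "rho_contraction \<rho> A"
  then have "dilation_inequality \<rho> A"
    by (rule rho_contraction_imp_dilation_inequality[OF assms(2,1)])
  then show "\<forall>z\<in>cball 0 1. \<forall>x. norm (A x) \<le> \<rho> * norm (x - (1 - 1 / \<rho>) *\<^sub>R cnj z *\<^sub>C A x)"
    using dilation_inequality_imp_resolvent_estimate[OF assms(2,1)] by simp
next
  assume est: "\<forall>z\<in>cball 0 1. \<forall>x. norm (A x) \<le> \<rho> * norm (x - (1 - 1 / \<rho>) *\<^sub>R cnj z *\<^sub>C A x)"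
  have "dilation_inequality \<rho> A"
  proof (rule resolvent_estimate_imp_dilation_inequality[OF assms(2,1)])
    fix z x assume "cmod z \<le> 1"
    then show "norm (A x) \<le> \<rho> * norm (x - (1 - 1 / \<rho>) *\<^sub>R z *\<^sub>C A x)"
      using est[rule_format, of "cnj z" x] by simp
  qed
  then show "rho_contraction \<rho> A"
    by (rule dilation_inequality_imp_rho_contraction[OF assms(2,1)])
qed

end
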